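(* For parameters $n,s,t,\varepsilon$, one can construct a probabilistic polynomial $\widetilde{P}_{n,s,t,\varepsilon}:\{0,1\}^n\to\mathbb{R}$ (a distribution over real polynomials in $x_1,\ldots,x_n$) of degree $O((1/\varepsilon)^{1/3}\log s)$ such that for every $x\in\{0,1\}^n$: (i) if $\sum_{i=1}^n x_i\le t$, then $|\widetilde{P}_{n,s,t,\varepsilon}(x)|\le 1$ with probability at least $1-1/s$; (ii) if $\sum_{i=1}^n x_i\in(t,t+\varepsilon n)$, then $\widetilde{P}_{n,s,t,\varepsilon}(x)>1$ with probability at least $1-1/s$; (iii) if $\sum_{i=1}^n x_i\ge t+\varepsilon n$, then $\widetilde{P}_{n,s,t,\varepsilon}(x)\ge s$ with probability at least $1-1/s$. Moreover, in the "exact" setting $\varepsilon=1/n$, the degree can alternatively be bounded by $O(n^{1/3}\log^{2/3}(ns))$. *)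

theory Defs
  imports "HOL-Probability.Probability" "HOL-Library.Poly_Mapping"
begin

text \<open>
  Multivariate real polynomials: a finitely supported map from monomials to coefficients, where a
  monomial is a finitely supported map from variable indices to exponents.
\<close>

type_synonym rpoly = "(nat \<Rightarrow>\<^sub>0 nat) \<Rightarrow>\<^sub>0 real"

definition vars :: "rpoly \<Rightarrow> nat set" where
  "vars p = (\<Union>m\<in>Poly_Mapping.keys p. Poly_Mapping.keys m)"

text \<open>The total degree; the zero polynomial has degree 0.\<close>

definition total_degree :: "rpoly \<Rightarrow> nat" where
  "total_degree p =
     Max (insert 0 ((\<lambda>m. \<Sum>i\<in>Poly_Mapping.keys m. Poly_Mapping.lookup m i) ` Poly_Mapping.keys p))"

definition eval_poly :: "rpoly \<Rightarrow> (nat \<Rightarrow> real) \<Rightarrow> real" where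
  "eval_poly p x =
     (\<Sum>m\<in>Poly_Mapping.keys p.
        Poly_Mapping.lookup p m * (\<Prod>i\<in>Poly_Mapping.keys m. x i ^ Poly_Mapping.lookup m i))"

text \<open>
  A probabilistic polynomial in \<open>x\<^sub>1, \<dots>, x\<^sub>n\<close> is a probability distribution over real polynomials
  in these variables; it has degree at most \<open>d\<close> if every polynomial in its support does.
\<close>

definition prob_poly :: "nat \<Rightarrow> rpoly pmf \<Rightarrow> bool" where
  "prob_poly n P \<longleftrightarrow> (\<forall>p\<in>set_pmf P. vars p \<subseteq> {1..n})"

definition prob_poly_degree_le :: "rpoly pmf \<Rightarrow> real \<Rightarrow> bool" where
  "prob_poly_degree_le P d \<longleftrightarrow> (\<forall>p\<in>set_pmf P. real (total_degree p) \<le> d)"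

end

theory Submission
  imports Defs
begin

text \<open>
  Let \<open>z\<close> be the sum of the bits and \<open>L \<approx> ln s\<close> (or \<open>L \<approx> ln (n s)\<close> in the exact setting). On a sample
  of \<open>m\<close> coordinates, drawn with replacement, the density is off by at most about \<open>sqrt (L / m)\<close>, so
  an exact threshold of the sample separates \<open>z \<le> t - w\<close> (value 0) from \<open>z > t\<close> (value 1) where
  \<open>w \<approx> n sqrt (L / m)\<close>. Multiply it by a univariate polynomial in \<open>z\<close> that is bounded by 1 on the
  window \<open>(t - w, t]\<close> only and is large above \<open>t\<close>.

  The exact threshold of \<open>m\<close> bits is a probabilistic polynomial of degree \<open>O(sqrt (m L))\<close>, by recursive
  sampling (Alman and Williams). The univariate factor is a Chebyshev polynomial of degree
  \<open>O(sqrt (w / (\<epsilon> n)) L)\<close>; in the exact setting it is a discrete Chebyshev polynomial of degree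
  \<open>O(sqrt (w L))\<close>, bounded at the integers of the window through its \<open>l\<^sub>2\<close> norm. Balancing the two
  degrees gives \<open>m \<approx> \<epsilon>\<^bsup>-2/3\<^esup> L\<close> and \<open>m \<approx> n\<^bsup>2/3\<^esup> L\<^bsup>1/3\<^esup>\<close>, respectively. For \<open>s \<le> 2\<close> the degree must
  be allowed to vanish, and a random constant works.
\<close>

section \<open>Polynomial functions\<close>

definition mon_eval :: "(nat \<Rightarrow>\<^sub>0 nat) \<Rightarrow> (nat \<Rightarrow> real) \<Rightarrow> real" where
  "mon_eval m x = (\<Prod>i\<in>Poly_Mapping.keys m. x i ^ Poly_Mapping.lookup m i)"

definition mon_degree :: "(nat \<Rightarrow>\<^sub>0 nat) \<Rightarrow> nat" where
  "mon_degree m = (\<Sum>i\<in>Poly_Mapping.keys m. Poly_Mapping.lookup m i)"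

lemma mon_eval_superset:
  assumes "finite A" "Poly_Mapping.keys m \<subseteq> A"
  shows "mon_eval m x = (\<Prod>i\<in>A. x i ^ Poly_Mapping.lookup m i)"
  unfolding mon_eval_def using assms
  by (intro prod.mono_neutral_left) (auto simp: in_keys_iff)

lemma mon_degree_superset:
  assumes "finite A" "Poly_Mapping.keys m \<subseteq> A"
  shows "mon_degree m = (\<Sum>i\<in>A. Poly_Mapping.lookup m i)"
  unfolding mon_degree_def using assms
  by (intro sum.mono_neutral_left) (auto simp: in_keys_iff)

lemma mon_eval_add: "mon_eval (a + b) x = mon_eval a x * mon_eval b x"
proof -
  let ?A = "Poly_Mapping.keys a \<union> Poly_Mapping.keys b"
  have "mon_eval (a + b) x = (\<Prod>i\<in>?A. x i ^ Poly_Mapping.lookup (a + b) i)"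
    using Poly_Mapping.keys_add[of a b] by (intro mon_eval_superset) auto
  also have "\<dots> = (\<Prod>i\<in>?A. x i ^ Poly_Mapping.lookup a i) * (\<Prod>i\<in>?A. x i ^ Poly_Mapping.lookup b i)"
    by (simp add: lookup_add power_add prod.distrib)
  also have "\<dots> = mon_eval a x * mon_eval b x"
    by (simp add: mon_eval_superset[of ?A])
  finally show ?thesis .
qed

lemma mon_degree_add: "mon_degree (a + b) = mon_degree a + mon_degree b"
proof -
  let ?A = "Poly_Mapping.keys a \<union> Poly_Mapping.keys b"
  have "mon_degree (a + b) = (\<Sum>i\<in>?A. Poly_Mapping.lookup (a + b) i)"
    using Poly_Mapping.keys_add[of a b] by (intro mon_degree_superset) auto
  also have "\<dots> = mon_degree a + mon_degree b"
    by (simp add: lookup_add sum.distrib mon_degree_superset[of ?A])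
  finally show ?thesis .
qed

lemma eval_poly_mon_eval:
  "eval_poly p x = (\<Sum>m\<in>Poly_Mapping.keys p. Poly_Mapping.lookup p m * mon_eval m x)"
  by (simp add: eval_poly_def mon_eval_def)

lemma total_degree_le_iff:
  "total_degree p \<le> d \<longleftrightarrow> (\<forall>m\<in>Poly_Mapping.keys p. mon_degree m \<le> d)"
  unfolding total_degree_def mon_degree_def by (subst Max_le_iff) auto

lemma eval_poly_add: "eval_poly (p + q) x = eval_poly p x + eval_poly q x"
  unfolding eval_poly_mon_eval
  by (rule setsum_keys_plus_distrib) (auto simp: algebra_simps)

definition represents :: "nat \<Rightarrow> nat \<Rightarrow> ((nat \<Rightarrow> real) \<Rightarrow> real) \<Rightarrow> rpoly \<Rightarrow> bool" where
  "represents n d f p \<longleftrightarrow>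
     vars p \<subseteq> {1..n} \<and> total_degree p \<le> d \<and> (\<forall>x. eval_poly p x = f x)"

lemma represents_monomial:
  assumes "Poly_Mapping.keys m \<subseteq> {1..n}" "mon_degree m \<le> d"
  shows "represents n d (\<lambda>x. c * mon_eval m x) (Poly_Mapping.single m c)"
  using assms by (auto simp: represents_def vars_def total_degree_le_iff eval_poly_mon_eval)

lemma represents_add:
  assumes "represents n d f p" "represents n d g q"
  shows "represents n d (\<lambda>x. f x + g x) (p + q)"
  using assms Poly_Mapping.keys_add[of p q]
  by (fastforce simp: represents_def vars_def total_degree_le_iff eval_poly_add)

lemma represents_sum:
  assumes "finite A" "\<And>a. a \<in> A \<Longrightarrow> represents n d (f a) (p a)"
  shows "represents n d (\<lambda>x. \<Sum>a\<in>A. f a x) (\<Sum>a\<in>A. p a)"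
  using assms
proof (induction A rule: finite_induct)
  case empty
  show ?case by (simp add: represents_def vars_def total_degree_le_iff eval_poly_def)
next
  case (insert a A)
  then show ?case using represents_add[of n d "f a" "p a"] by simp
qed

text \<open>Polynomials in \<open>x\<^sub>1, \<dots>, x\<^sub>n\<close> of degree at most \<open>d\<close>, viewed as functions; in this form the
  substitution of variables by variables is composition.\<close>

inductive polyfun :: "nat \<Rightarrow> nat \<Rightarrow> ((nat \<Rightarrow> real) \<Rightarrow> real) \<Rightarrow> bool" for n where
  const: "polyfun n 0 (\<lambda>x. c)"
| var: "i \<in> {1..n} \<Longrightarrow> polyfun n 1 (\<lambda>x. x i)"
| add: "polyfun n d f \<Longrightarrow> polyfun n d g \<Longrightarrow> polyfun n d (\<lambda>x. f x + g x)"
| mult: "polyfun n d f \<Longrightarrow> polyfun n e g \<Longrightarrow> polyfun n (d + e) (\<lambda>x. f x * g x)"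
| mono: "polyfun n d f \<Longrightarrow> d \<le> e \<Longrightarrow> polyfun n e f"

text \<open>Induction over the way the function is built. Only products need work: they expand into
  a double sum of monomials, each within the bound because \<open>mon_degree\<close> is additive.
  Monomials may collide or cancel, which is harmless since \<open>represents\<close> only bounds the
  degree from above.\<close>

lemma polyfun_represents:
  assumes "polyfun n d f"
  shows "\<exists>p. represents n d f p"
  using assms
proof (induction rule: polyfun.induct)
  case (const c)
  show ?case using represents_monomial[of 0 n 0 c]
    by (auto simp: mon_eval_def mon_degree_def)
next
  case (var i)
  then show ?case using represents_monomial[of "Poly_Mapping.single i 1" n 1 1]
    by (auto simp: mon_eval_def mon_degree_def)
next
  case (add d f g)
  then show ?case using represents_add by blast
next
  case (mult d f e g)
  then obtain p q where p: "represents n d f p" and q: "represents n e g q" by blast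
  let ?r = "\<lambda>a b. Poly_Mapping.single (a + b) (Poly_Mapping.lookup p a * Poly_Mapping.lookup q b)"
  have "represents n (d + e)
      (\<lambda>x. \<Sum>a\<in>Poly_Mapping.keys p. \<Sum>b\<in>Poly_Mapping.keys q.
         (Poly_Mapping.lookup p a * Poly_Mapping.lookup q b) * mon_eval (a + b) x)
      (\<Sum>a\<in>Poly_Mapping.keys p. \<Sum>b\<in>Poly_Mapping.keys q. ?r a b)"
  proof (intro represents_sum represents_monomial)
    fix a b assume ab: "a \<in> Poly_Mapping.keys p" "b \<in> Poly_Mapping.keys q"
    show "Poly_Mapping.keys (a + b) \<subseteq> {1..n}"
      using ab p q Poly_Mapping.keys_add[of a b] unfolding represents_def vars_def by blast
    show "mon_degree (a + b) \<le> d + e"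
      using ab p q by (auto simp: represents_def total_degree_le_iff mon_degree_add add_mono)
  qed auto
  moreover have "(\<lambda>x. \<Sum>a\<in>Poly_Mapping.keys p. \<Sum>b\<in>Poly_Mapping.keys q.
         (Poly_Mapping.lookup p a * Poly_Mapping.lookup q b) * mon_eval (a + b) x) = (\<lambda>x. f x * g x)"
  proof
    fix x
    have "f x * g x = eval_poly p x * eval_poly q x" using p q by (simp add: represents_def)
    then show "(\<Sum>a\<in>Poly_Mapping.keys p. \<Sum>b\<in>Poly_Mapping.keys q.
         (Poly_Mapping.lookup p a * Poly_Mapping.lookup q b) * mon_eval (a + b) x) = f x * g x"
      by (simp add: eval_poly_mon_eval sum_product mon_eval_add mult_ac)
  qed
  ultimately show ?case by auto
next
  case (mono d f e)
  then show ?case by (auto simp: represents_def intro: order_trans)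
qed

text \<open>Putting variables for variables leaves the degree alone. The map \<open>\<sigma>\<close>
  need not be injective, as sampling with replacement requires.\<close>

lemma polyfun_subst:
  assumes "polyfun m d f" "\<And>i. i \<in> {1..m} \<Longrightarrow> \<sigma> i \<in> {1..n}"
  shows "polyfun n d (\<lambda>x. f (\<lambda>i. x (\<sigma> i)))"
  using assms
proof (induction rule: polyfun.induct)
  case (var i)
  then show ?case by (intro polyfun.var)
qed (auto intro: polyfun.intros)

lemma polyfun_sum_vars: "k \<le> n \<Longrightarrow> polyfun n 1 (\<lambda>x. \<Sum>i=1..k. x i)"
proof (induction k)
  case 0
  show ?case by (auto intro: polyfun.mono[OF polyfun.const])
next
  case (Suc k)
  then show ?case
    by (auto intro!: polyfun.add polyfun.var[of "Suc k", simplified])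
qed

text \<open>Horner's scheme: each \<open>pCons\<close> multiplies once more by the linear
  form.\<close>

lemma polyfun_poly: "polyfun n (degree p) (\<lambda>x. poly p (\<Sum>i=1..n. x i))"
proof (induction p)
  case 0
  show ?case by (simp add: polyfun.const)
next
  case (pCons a p)
  show ?case
  proof (cases "p = 0")
    case True
    then show ?thesis by (simp add: polyfun.const)
  next
    case False
    have "polyfun n (1 + degree p) (\<lambda>x. (\<Sum>i=1..n. x i) * poly p (\<Sum>i=1..n. x i))"
      by (intro polyfun.mult polyfun_sum_vars pCons.IH) simp
    then have "polyfun n (1 + degree p) (\<lambda>x. a + (\<Sum>i=1..n. x i) * poly p (\<Sum>i=1..n. x i))"
      by (intro polyfun.add polyfun.mono[OF polyfun.const]) auto
    then show ?thesis using False by simp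
  qed
qed

section \<open>Thresholds by recursive sampling\<close>

text \<open>Newton's scheme: the new node is fitted by adding a multiple of the nodal polynomial
  \<open>q\<close> of the old nodes, which vanishes at them but not at the new one.\<close>

lemma lagrange_interpolation:
  fixes S :: "'a :: field set"
  assumes "finite S"
  shows "\<exists>p. degree p \<le> card S - 1 \<and> (\<forall>z\<in>S. poly p z = f z)"
  using assms
proof (induction S rule: finite_induct)
  case empty
  show ?case by (intro exI[of _ 0]) auto
next
  case (insert a S)
  then obtain p where p: "degree p \<le> card S - 1" "\<forall>z\<in>S. poly p z = f z" by blast
  define q where "q = (\<Prod>b\<in>S. [:- b, 1:])"
  have q: "poly q z = (\<Prod>b\<in>S. z - b)" for z by (simp add: q_def poly_prod)
  have "degree q = card S"
    unfolding q_def by (subst degree_prod_eq_sum_degree) auto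
  have "poly q a \<noteq> 0" using insert by (auto simp: q)
  have "poly q z = 0" if "z \<in> S" for z using that insert by (auto simp: q)
  let ?r = "p + smult ((f a - poly p a) / poly q a) q"
  have "degree ?r \<le> card (insert a S) - 1"
    using p(1) \<open>degree q = card S\<close> insert
    by (intro degree_add_le order_trans[OF degree_smult_le]) auto
  moreover have "poly ?r z = f z" if "z \<in> insert a S" for z
    using that p(2) \<open>poly q a \<noteq> 0\<close> \<open>\<And>z. z \<in> S \<Longrightarrow> poly q z = 0\<close> by auto
  ultimately show ?case by blast
qed

lemma card_nat_near_le:
  fixes \<theta> r :: real
  assumes "r \<ge> 0"
  shows "finite {k::nat. \<bar>real k - \<theta>\<bar> \<le> r}" "real (card {k::nat. \<bar>real k - \<theta>\<bar> \<le> r}) \<le> 2 * r + 1"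
proof -
  let ?T = "{k::nat. \<bar>real k - \<theta>\<bar> \<le> r}" and ?I = "{\<lceil>\<theta> - r\<rceil>..\<lfloor>\<theta> + r\<rfloor>}"
  have sub: "int ` ?T \<subseteq> ?I" by (auto simp: abs_le_iff le_floor_iff ceiling_le_iff)
  then have "finite (int ` ?T)" by (rule finite_subset) simp
  then show "finite ?T" by (rule finite_imageD) (auto simp: inj_on_def)
  have "card ?T = card (int ` ?T)" by (simp add: card_image inj_on_def)
  also have "\<dots> \<le> card ?I" using sub by (intro card_mono) auto
  finally have "real (card ?T) \<le> real (nat (\<lfloor>\<theta> + r\<rfloor> - \<lceil>\<theta> - r\<rceil> + 1))" by simp
  also have "\<dots> \<le> 2 * r + 1"
  proof (cases "\<lfloor>\<theta> + r\<rfloor> - \<lceil>\<theta> - r\<rceil> + 1 \<ge> 0")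
    case True
    have "real_of_int \<lfloor>\<theta> + r\<rfloor> \<le> \<theta> + r" "\<theta> - r \<le> real_of_int \<lceil>\<theta> - r\<rceil>"
      by (rule of_int_floor_le le_of_int_ceiling)+
    then have "real_of_int (\<lfloor>\<theta> + r\<rfloor> - \<lceil>\<theta> - r\<rceil> + 1) \<le> 2 * r + 1"
      unfolding of_int_add of_int_diff of_int_1 by linarith
    moreover have "real (nat (\<lfloor>\<theta> + r\<rfloor> - \<lceil>\<theta> - r\<rceil> + 1)) = real_of_int (\<lfloor>\<theta> + r\<rfloor> - \<lceil>\<theta> - r\<rceil> + 1)"
      using True by (rule of_nat_nat)
    ultimately show ?thesis by (simp only:)
  qed (use assms in simp)
  finally show "real (card ?T) \<le> 2 * r + 1" .
qed

text \<open>An interval of length \<open>2 * r\<close> holds at most \<open>2 * r + 1\<close>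
  integers, and interpolation needs a degree one less than the number of nodes.\<close>

lemma threshold_interpolation:
  fixes \<theta> r :: real
  assumes "r \<ge> 0"
  shows "\<exists>p :: real poly. real (degree p) \<le> 2 * r \<and>
           (\<forall>k::nat. \<bar>real k - \<theta>\<bar> \<le> r \<longrightarrow> poly p (real k) = of_bool (\<theta> < real k))"
proof -
  let ?T = "{k::nat. \<bar>real k - \<theta>\<bar> \<le> r}"
  from lagrange_interpolation[of "real ` ?T" "\<lambda>z. of_bool (\<theta> < z)"] card_nat_near_le(1)[OF assms]
  obtain p :: "real poly" where p: "degree p \<le> card (real ` ?T) - 1"
    "\<forall>z\<in>real ` ?T. poly p z = of_bool (\<theta> < z)" by blast
  have "real (degree p) \<le> 2 * r"
    using p(1) card_nat_near_le(2)[OF assms, of \<theta>] assms by (simp add: card_image inj_on_def)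
  with p(2) show ?thesis by auto
qed

section \<open>Sampling with replacement and concentration\<close>

text \<open>Union bound for a two-stage experiment: averaging over the first stage, the conditional
  failure probability is dominated by the indicator of \<open>bad\<close> plus
  \<open>\<beta>\<close>.\<close>

lemma prob_bind_pmf_le:
  assumes M: "measure_pmf.prob M {a. bad a} \<le> \<alpha>"
    and N: "\<And>a. a \<in> set_pmf M \<Longrightarrow> \<not> bad a \<Longrightarrow> measure_pmf.prob (N a) X \<le> \<beta>"
    and "\<beta> \<ge> 0"
  shows "measure_pmf.prob (bind_pmf M N) X \<le> \<alpha> + \<beta>"
proof -
  have "measure_pmf.prob (bind_pmf M N) X = (\<integral>a. measure_pmf.prob (N a) X \<partial>measure_pmf M)"
    unfolding measure_pmf_bind
    by (subst measure_pmf.measure_bind[where N="count_space UNIV"])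
       (auto simp: measure_pmf_in_subprob_space)
  also have "\<dots> \<le> (\<integral>a. indicator {a. bad a} a + \<beta> \<partial>measure_pmf M)"
  proof (intro integral_mono_AE)
    show "AE a in measure_pmf M. measure_pmf.prob (N a) X \<le> indicator {a. bad a} a + \<beta>"
      using N \<open>\<beta> \<ge> 0\<close> by (auto simp: AE_measure_pmf_iff indicator_def add_increasing2)
    show "integrable (measure_pmf M) (\<lambda>a. measure_pmf.prob (N a) X)"
      by (intro measure_pmf.integrable_const_bound[where B = 1]) auto
    show "integrable (measure_pmf M) (\<lambda>a. indicator {a. bad a} a + \<beta>)"
      by (intro Bochner_Integration.integrable_add)
         (auto intro!: integrable_real_indicator simp: measure_pmf.emeasure_eq_measure)
  qed
  also have "\<dots> = measure_pmf.prob M {a. bad a} + \<beta>"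
    by (subst Bochner_Integration.integral_add) (auto simp: measure_pmf.emeasure_eq_measure)
  finally show ?thesis using M by simp
qed

text \<open>Independent uniform draws, so that Hoeffding's inequality applies; \<open>1\<close> is
  the default value that \<open>Pi_pmf\<close> assigns outside \<open>{1..m}\<close>.\<close>

definition sample_pmf :: "nat \<Rightarrow> nat \<Rightarrow> (nat \<Rightarrow> nat) pmf" where
  "sample_pmf m n = Pi_pmf {1..m} 1 (\<lambda>_. pmf_of_set {1..n})"

lemma sample_pmf_range:
  assumes "n \<ge> 1" "\<sigma> \<in> set_pmf (sample_pmf m n)" "i \<in> {1..m}"
  shows "\<sigma> i \<in> {1..n}"
proof -
  have "set_pmf (sample_pmf m n) \<subseteq> PiE_dflt {1..m} 1 (set_pmf \<circ> (\<lambda>_. pmf_of_set {1..n}))"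
    unfolding sample_pmf_def by (rule set_Pi_pmf_subset') auto
  then show ?thesis using assms by (auto simp: PiE_dflt_def)
qed

text \<open>Every coordinate of the sample is uniform on \<open>{1..n}\<close>, so the bits
  \<open>x (\<sigma> i)\<close> are independent and identically distributed, and their mean is the
  true density.\<close>

lemma sample_pmf_Hoeffding:
  fixes x :: "nat \<Rightarrow> real"
  assumes x: "x \<in> {1..n} \<rightarrow> {0, 1}" and "n \<ge> 1" "m \<ge> 1" "b \<ge> 0"
  shows "measure_pmf.prob (sample_pmf m n)
           {\<sigma>. \<bar>(\<Sum>i=1..m. x (\<sigma> i)) / real m - (\<Sum>i=1..n. x i) / real n\<bar> \<ge> b}
         \<le> 2 * exp (- 2 * real m * b\<^sup>2)"
proof -
  let ?M = "sample_pmf m n"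
  have comp: "map_pmf (\<lambda>\<sigma>. \<sigma> i) ?M = pmf_of_set {1..n}" if "i \<in> {1..m}" for i
    using that by (simp add: sample_pmf_def Pi_pmf_component)
  have distr: "distr (measure_pmf ?M) borel (\<lambda>\<sigma>. x (\<sigma> i)) = distr (measure_pmf (pmf_of_set {1..n})) borel x"
    if "i \<in> {1..m}" for i
    unfolding comp[OF that, symmetric] map_pmf_rep_eq by (subst distr_distr) (auto simp: o_def)
  interpret Hoeffding_ineq_iid ?M "{1..m}" "\<lambda>i \<sigma>. x (\<sigma> i)" "\<lambda>\<sigma>. x (\<sigma> 1)" 0 1 "(\<Sum>i=1..n. x i) / real n"
  proof unfold_locales
    show "prob_space.indep_vars (measure_pmf ?M) (\<lambda>_. borel) (\<lambda>i \<sigma>. x (\<sigma> i)) {1..m}"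
      unfolding sample_pmf_def
      by (intro prob_space.indep_vars_compose2[OF _ indep_vars_Pi_pmf])
         (auto simp: measure_pmf.prob_space_axioms)
    show "distr (measure_pmf ?M) borel (\<lambda>\<sigma>. x (\<sigma> i)) = distr (measure_pmf ?M) borel (\<lambda>\<sigma>. x (\<sigma> 1))"
      if "i \<in> {1..m}" for i
      using distr[OF that] distr[of 1] assms by simp
    show "AE \<sigma> in measure_pmf ?M. x (\<sigma> 1) \<in> {0..1}"
      unfolding AE_measure_pmf_iff
    proof
      fix \<sigma> assume "\<sigma> \<in> set_pmf ?M"
      then have "\<sigma> 1 \<in> {1..n}"
        by (rule sample_pmf_range[OF \<open>n \<ge> 1\<close>]) (use \<open>m \<ge> 1\<close> in auto)
      then have "x (\<sigma> 1) \<in> {0, 1}" by (rule Pi_mem[OF x])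
      then show "x (\<sigma> 1) \<in> {0..1}" by auto
    qed
    have "measure_pmf.expectation ?M (\<lambda>\<sigma>. x (\<sigma> 1))
        = measure_pmf.expectation (map_pmf (\<lambda>\<sigma>. \<sigma> 1) ?M) x" by simp
    also have "\<dots> = (\<Sum>i=1..n. x i) / real n"
      using assms by (subst comp) (auto simp: integral_pmf_of_set)
    finally show "(\<Sum>i=1..n. x i) / real n \<equiv> measure_pmf.expectation ?M (\<lambda>\<sigma>. x (\<sigma> 1))" by simp
  qed (auto simp: sample_pmf_def)
  show ?thesis
    using Hoeffding_ineq_abs_ge'[of b] assms by simp
qed

lemma sum_01_is_nat:
  fixes x :: "nat \<Rightarrow> real"
  assumes "x \<in> {1..n} \<rightarrow> {0, 1}"
  shows "\<exists>k\<le>n. (\<Sum>i=1..n. x i) = real k"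
proof -
  have "(\<Sum>i=1..n. x i) = (\<Sum>i\<in>{1..n}. of_bool (x i = 1))"
    using assms by (intro sum.cong) (auto simp: Pi_iff)
  also have "\<dots> = real (card ({1..n} \<inter> {i. x i = 1}))" by simp
  finally show ?thesis
    by (intro exI[of _ "card ({1..n} \<inter> {i. x i = 1})"]) (auto intro: order_trans[OF card_mono[of "{1..n}"]])
qed

text \<open>If the sampled density is within \<open>b\<close> of the true one, the exact thresholds of the sample at
  the levels \<open>\<theta>/n \<plusminus> b\<close> agree unless the sum is within \<open>2 b n\<close> of \<open>\<theta>\<close>, where a low-degree
  interpolation polynomial is exact. Both levels use the same random sample, so the degrees add up
  along a single chain of nested samples, and the failure probability does not double.\<close>

lemma random_threshold:
  fixes L :: real
  assumes "L \<ge> 1"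
  shows "\<exists>D :: (real \<Rightarrow> (nat \<Rightarrow> real) \<Rightarrow> real) pmf.
    (\<forall>F\<in>set_pmf D. \<forall>\<theta>. \<exists>d. polyfun n d (F \<theta>) \<and> real d \<le> 48 * sqrt (real n * L)) \<and>
    (\<forall>x \<in> {1..n} \<rightarrow> {0, 1}.
       measure_pmf.prob D {F. \<not> (\<forall>\<theta>. F \<theta> x = of_bool (\<theta> < (\<Sum>i=1..n. x i)))} \<le> exp (- L))"
  using assms
proof (induction n arbitrary: L rule: less_induct)
  case (less n)
  show ?case
  proof (cases "n < 16")
    case True
    \<comment> \<open>Few variables: interpolation at all \<open>n + 1\<close> possible sums is
      exact without any randomness, and its degree \<open>n\<close> fits the bound because
      \<open>n < 16\<close> and \<open>L \<ge> 1\<close>.\<close>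
    have "\<exists>p :: real poly. degree p \<le> n \<and> (\<forall>k\<le>n. poly p (real k) = of_bool (\<theta> < real k))" for \<theta>
      using lagrange_interpolation[of "real ` {..n}" "\<lambda>z. of_bool (\<theta> < z)"]
      by (auto simp: card_image)
    then obtain A :: "real \<Rightarrow> real poly" where A: "\<And>\<theta>. degree (A \<theta>) \<le> n"
      "\<And>\<theta> k. k \<le> n \<Longrightarrow> poly (A \<theta>) (real k) = of_bool (\<theta> < real k)" by metis
    define F where "F \<theta> x = poly (A \<theta>) (\<Sum>i=1..n. x i)" for \<theta> x
    have "real n \<le> 48 * sqrt (real n * L)"
    proof -
      have "real n * real n \<le> 16 * (real n * L)"
        using True \<open>L \<ge> 1\<close> mult_mono[of "real n" "16 * L" "real n" "real n"] by (simp add: mult_ac)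
      moreover have "0 \<le> real n * L" using \<open>L \<ge> 1\<close> by simp
      ultimately have "real n * real n \<le> 2304 * (real n * L)" by linarith
      then have "(real n)\<^sup>2 \<le> (48 * sqrt (real n * L))\<^sup>2"
        using \<open>L \<ge> 1\<close> by (simp add: power2_eq_square)
      then show ?thesis by (rule power2_le_imp_le) (use \<open>L \<ge> 1\<close> in simp)
    qed
    then have "\<exists>d. polyfun n d (F \<theta>) \<and> real d \<le> 48 * sqrt (real n * L)" for \<theta>
      using polyfun_poly[of n "A \<theta>"] A(1)[of \<theta>]
      by (intro exI[of _ n]) (auto simp: F_def[abs_def] intro: polyfun.mono)
    moreover have "F \<theta> x = of_bool (\<theta> < (\<Sum>i=1..n. x i))" if "x \<in> {1..n} \<rightarrow> {0, 1}" for x \<theta>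
      using sum_01_is_nat[OF that] A(2) by (auto simp: F_def)
    ultimately show ?thesis
      by (intro exI[of _ "return_pmf F"]) auto
  next
    case False
    \<comment> \<open>For \<open>n \<ge> 16\<close> rounding costs at most a factor 2, so
      \<open>m\<close> lies between \<open>n / 32\<close> and \<open>n / 16\<close>: large enough
      for concentration, small enough for the degrees to shrink geometrically along the
      recursion.\<close>
    define m where "m = n div 16"
    obtain k where k: "n = 16 * m + k" "k < 16"
      unfolding m_def by (metis mod_less_divisor mult_div_mod_eq zero_less_numeral)
    then have "m \<ge> 1" using False by linarith
    with k have "m \<ge> 1" "m < n" "n \<le> m * 32" "m * 16 \<le> n" by linarith+
    moreover from this(3,4) have "real n \<le> real (m * 32)" "real (m * 16) \<le> real n"
      by (simp_all only: of_nat_le_iff)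
    ultimately have m: "m \<ge> 1" "m < n" "real m \<ge> real n / 32" "real m \<le> real n / 16"
      by simp_all
    have n: "n \<ge> 1" using False by simp
    \<comment> \<open>The recursive call gets exponent \<open>L + 1\<close> and the sampling below
      gets \<open>L + 2\<close>, so that both failures together fit into
      \<open>exp (- L)\<close>.\<close>
    have "L + 1 \<ge> 1" using less.prems by simp
    from less.IH[OF m(2) this]
    obtain D :: "(real \<Rightarrow> (nat \<Rightarrow> real) \<Rightarrow> real) pmf" where
      D1: "\<And>F \<theta>. F \<in> set_pmf D \<Longrightarrow> \<exists>d. polyfun m d (F \<theta>) \<and> real d \<le> 48 * sqrt (real m * (L + 1))"
      and D2: "\<And>x. x \<in> {1..m} \<rightarrow> {0, 1} \<Longrightarrow>
       measure_pmf.prob D {F. \<not> (\<forall>\<theta>. F \<theta> x = of_bool (\<theta> < (\<Sum>i=1..m. x i)))} \<le> exp (- (L + 1))"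
      by blast
    \<comment> \<open>Solves \<open>2 * m * b\<^sup>2 = L + 2\<close>, the exponent in Hoeffding's
      bound.\<close>
    define b where "b = sqrt ((L + 2) / (2 * real m))"
    have b: "b > 0" "2 * real m * b\<^sup>2 = L + 2" "b\<^sup>2 = (L + 2) / (2 * real m)"
      using m(1) less.prems by (auto simp: b_def)
    define r where "r = 2 * b * real n"
    have "r \<ge> 0" using b by (simp add: r_def)
    from threshold_interpolation[OF this]
    obtain A :: "real \<Rightarrow> real poly" where A: "\<And>\<theta>. real (degree (A \<theta>)) \<le> 2 * r"
      "\<And>\<theta> k. \<bar>real k - \<theta>\<bar> \<le> r \<Longrightarrow> poly (A \<theta>) (real k) = of_bool (\<theta> < real k)" by metis
    define lo hi where "lo \<theta> = real m * (\<theta> / real n - b)" and "hi \<theta> = real m * (\<theta> / real n + b)" for \<theta>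
    \<comment> \<open>A selector: where the thresholds at \<open>hi\<close> and \<open>lo\<close>
      agree, their common value is returned; where only \<open>lo\<close> is passed, the
      interpolation polynomial decides. Both levels use the same \<open>F\<close>, and
      \<open>G\<close> is affine in their values, so only the degree of \<open>A \<theta>\<close> is
      added.\<close>
    define G where "G \<sigma> F \<theta> x =
      F (hi \<theta>) (\<lambda>i. x (\<sigma> i)) + poly (A \<theta>) (\<Sum>i=1..n. x i) *
        (F (lo \<theta>) (\<lambda>i. x (\<sigma> i)) + (- 1) * F (hi \<theta>) (\<lambda>i. x (\<sigma> i)))"
      for \<sigma> :: "nat \<Rightarrow> nat" and F \<theta> and x :: "nat \<Rightarrow> real"
    define E where "E = bind_pmf (sample_pmf m n) (\<lambda>\<sigma>. map_pmf (G \<sigma>) D)"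
    \<comment> \<open>In units of \<open>sqrt (n * L)\<close>, interpolation costs at most 28, since
      \<open>768 \<le> 28\<^sup>2\<close>, and the recursion at most \<open>48 * 2 / 5\<close>,
      since \<open>1 / 8 \<le> (2 / 5)\<^sup>2\<close>. The total is below 48, so the induction
      closes with this constant.\<close>
    have deg: "2 * r + 48 * sqrt (real m * (L + 1)) \<le> 48 * sqrt (real n * L)"
    proof -
      have "(2 * r)\<^sup>2 = 16 * (real n)\<^sup>2 * ((L + 2) / (2 * real m))"
        by (simp add: r_def power_mult_distrib b(3))
      also have "\<dots> \<le> 16 * (real n)\<^sup>2 * ((3 * L) / (real n / 16))"
        using m n less.prems by (intro mult_left_mono frac_le) auto
      also have "\<dots> = 768 * (real n * L)" using n by (simp add: power2_eq_square)
      also have "\<dots> \<le> (28 * sqrt (real n * L))\<^sup>2" using less.prems by simp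
      finally have 1: "2 * r \<le> 28 * sqrt (real n * L)"
        by (rule power2_le_imp_le) (use less.prems in simp)
      have "real m * (L + 1) \<le> real n / 16 * (2 * L)"
        using m less.prems by (intro mult_mono) auto
      also have "\<dots> \<le> (2 / 5 * sqrt (real n * L))\<^sup>2"
        using less.prems by (simp add: power_mult_distrib field_simps)
      finally have 2: "sqrt (real m * (L + 1)) \<le> 2 / 5 * sqrt (real n * L)"
        using less.prems by (intro real_le_lsqrt) auto
      have "0 \<le> sqrt (real n * L)" using less.prems by simp
      with 1 2 show ?thesis by linarith
    qed
    have "\<exists>d. polyfun n d (H \<theta>) \<and> real d \<le> 48 * sqrt (real n * L)" if "H \<in> set_pmf E" for H \<theta>
    proof -
      from that obtain \<sigma> F where \<sigma>: "\<sigma> \<in> set_pmf (sample_pmf m n)" and F: "F \<in> set_pmf D"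
        and H: "H = G \<sigma> F" by (auto simp: E_def)
      from D1[OF F] obtain d1 d2 where d: "polyfun m d1 (F (hi \<theta>))" "polyfun m d2 (F (lo \<theta>))"
        "real d1 \<le> 48 * sqrt (real m * (L + 1))" "real d2 \<le> 48 * sqrt (real m * (L + 1))" by metis
      define e where "e = max d1 d2"
      have s: "polyfun n e (\<lambda>x. F (hi \<theta>) (\<lambda>i. x (\<sigma> i)))" "polyfun n e (\<lambda>x. F (lo \<theta>) (\<lambda>i. x (\<sigma> i)))"
        by (rule polyfun.mono[OF polyfun_subst[OF d(1)]] polyfun.mono[OF polyfun_subst[OF d(2)]],
            use sample_pmf_range[OF n \<sigma>] in \<open>auto simp: e_def\<close>)+
      have "polyfun n e (\<lambda>x. (- 1) * F (hi \<theta>) (\<lambda>i. x (\<sigma> i)))"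
        using polyfun.mult[OF polyfun.const[of n "- 1"] s(1)] by simp
      then have "polyfun n (degree (A \<theta>) + e) (H \<theta>)"
        unfolding H G_def[abs_def]
        by (intro polyfun.add polyfun.mult polyfun_poly s polyfun.mono[OF s(1)]) simp
      moreover have "real (degree (A \<theta>) + e) \<le> 48 * sqrt (real n * L)"
        using A(1)[of \<theta>] d(3,4) deg by (auto simp: e_def max_def)
      ultimately show ?thesis by blast
    qed
    moreover have "measure_pmf.prob E {H. \<not> (\<forall>\<theta>. H \<theta> x = of_bool (\<theta> < (\<Sum>i=1..n. x i)))} \<le> exp (- L)"
      if x: "x \<in> {1..n} \<rightarrow> {0, 1}" for x
    proof -
      let ?z = "\<Sum>i=1..n. x i"
      define bad where "bad \<sigma> \<longleftrightarrow> \<bar>(\<Sum>i=1..m. x (\<sigma> i)) / real m - ?z / real n\<bar> \<ge> b" for \<sigma>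
      have "measure_pmf.prob E {H. \<not> (\<forall>\<theta>. H \<theta> x = of_bool (\<theta> < ?z))}
          \<le> 2 * exp (- 2 * real m * b\<^sup>2) + exp (- (L + 1))"
        unfolding E_def
      proof (rule prob_bind_pmf_le[where bad = bad])
        show "measure_pmf.prob (sample_pmf m n) {a. bad a} \<le> 2 * exp (- 2 * real m * b\<^sup>2)"
          unfolding bad_def using b by (intro sample_pmf_Hoeffding[OF x n m(1)]) simp
        fix \<sigma> assume \<sigma>: "\<sigma> \<in> set_pmf (sample_pmf m n)" "\<not> bad \<sigma>"
        let ?x = "\<lambda>i. x (\<sigma> i)"
        let ?y = "\<Sum>i=1..m. ?x i"
        have x': "?x \<in> {1..m} \<rightarrow> {0, 1}" using x sample_pmf_range[OF n \<sigma>(1)] by (auto simp: Pi_iff)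
        have G: "G \<sigma> F \<theta> x = of_bool (\<theta> < ?z)" if F: "\<forall>\<theta>. F \<theta> ?x = of_bool (\<theta> < ?y)" for F \<theta>
        proof -
          have hi: "hi \<theta> < ?y \<longleftrightarrow> \<theta> / real n + b < ?y / real m"
            and lo: "lo \<theta> < ?y \<longleftrightarrow> \<theta> / real n - b < ?y / real m"
            using m(1) by (auto simp: hi_def lo_def field_simps)
          have z: "\<theta> < ?z \<longleftrightarrow> \<theta> / real n < ?z / real n"
            using n by (auto simp: field_simps)
          have near: "\<bar>?y / real m - ?z / real n\<bar> < b" using \<sigma>(2) by (simp add: bad_def)
          consider "hi \<theta> < ?y" | "\<not> lo \<theta> < ?y" | "\<not> hi \<theta> < ?y" "lo \<theta> < ?y" by blast
          then show ?thesis
          proof cases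
            case 1
            then have "lo \<theta> < ?y" "\<theta> < ?z" using near b(1) unfolding z hi lo abs_less_iff by linarith+
            then show ?thesis using F 1 by (simp add: G_def)
          next
            case 2
            then have "\<not> hi \<theta> < ?y" "\<not> \<theta> < ?z" using near b(1) unfolding z hi lo abs_less_iff by linarith+
            then show ?thesis using F 2 by (simp add: G_def)
          next
            case 3
            \<comment> \<open>The sampled density is within \<open>b\<close> of
              \<open>\<theta> / n\<close> and of the true density, so the sum falls into the range
              where \<open>A \<theta>\<close> is exact.\<close>
            then have "\<bar>?z / real n - \<theta> / real n\<bar> \<le> 2 * b"
              using near unfolding hi lo abs_less_iff abs_le_iff by linarith
            then have "\<bar>?z - \<theta>\<bar> / real n \<le> 2 * b" by (simp add: abs_divide flip: diff_divide_distrib)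
            then have "\<bar>?z - \<theta>\<bar> \<le> r" using n by (simp add: r_def field_simps)
            moreover obtain k where "?z = real k" using sum_01_is_nat[OF x] by blast
            ultimately have "poly (A \<theta>) ?z = of_bool (\<theta> < ?z)" using A(2)[of k \<theta>] by simp
            then show ?thesis using F 3 by (simp add: G_def)
          qed
        qed
        have "measure_pmf.prob (map_pmf (G \<sigma>) D) {H. \<not> (\<forall>\<theta>. H \<theta> x = of_bool (\<theta> < ?z))}
            = measure_pmf.prob D {F. \<not> (\<forall>\<theta>. G \<sigma> F \<theta> x = of_bool (\<theta> < ?z))}"
          by simp
        also have "\<dots> \<le> measure_pmf.prob D {F. \<not> (\<forall>\<theta>. F \<theta> ?x = of_bool (\<theta> < ?y))}"
          by (rule measure_pmf.finite_measure_mono) (use G in blast, simp)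
        also have "\<dots> \<le> exp (- (L + 1))" by (rule D2[OF x'])
        finally show "measure_pmf.prob (map_pmf (G \<sigma>) D) {H. \<not> (\<forall>\<theta>. H \<theta> x = of_bool (\<theta> < ?z))}
            \<le> exp (- (L + 1))" .
      qed simp
      \<comment> \<open>The remaining factor \<open>2 * exp (- 2) + exp (- 1)\<close> is at most 1,
        because \<open>exp (- 1) \<le> 1 / 2\<close>.\<close>
      also have "\<dots> = exp (- L) * (2 * (exp (- 1) * exp (- 1)) + exp (- 1))"
      proof -
        have "- 2 * real m * b\<^sup>2 = - L + (- 1 + - 1)" "- (L + 1) = - L + - 1" using b(2) by auto
        then show ?thesis by (simp only: exp_add) (simp add: algebra_simps)
      qed
      also have "\<dots> \<le> exp (- L) * 1"
      proof (intro mult_left_mono)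
        have e: "exp (- 1) \<le> (1 / 2 :: real)"
          using exp_ge_add_one_self[of "1::real"] by (simp add: exp_minus field_simps)
        have "exp (- 1) * exp (- 1) \<le> (1 / 2 :: real) * (1 / 2)"
          by (intro mult_mono e) auto
        with e show "2 * (exp (- 1) * exp (- 1)) + exp (- 1) \<le> (1 :: real)" by simp
      qed simp
      finally show ?thesis by simp
    qed
    ultimately show ?thesis by blast
  qed
qed

section \<open>A sampled threshold times a univariate polynomial\<close>

text \<open>A representing formal polynomial is chosen for each function in the support; evaluation
  agrees, so events about the value at a point keep their probability.\<close>

lemma realise_polyfun_pmf:
  assumes "\<And>f. f \<in> set_pmf D \<Longrightarrow> polyfun n d f"
  shows "\<exists>P. prob_poly n P \<and> (\<forall>p\<in>set_pmf P. total_degree p \<le> d) \<and>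
           (\<forall>x B. measure_pmf.prob P {p. B (eval_poly p x)} = measure_pmf.prob D {f. B (f x)})"
proof -
  from assms polyfun_represents obtain rep where
    rep: "\<And>f. f \<in> set_pmf D \<Longrightarrow> represents n d f (rep f)" by metis
  have "measure_pmf.prob (map_pmf rep D) {p. B (eval_poly p x)} = measure_pmf.prob D {f. B (f x)}" for x B
    unfolding measure_map_pmf
    by (rule measure_pmf.finite_measure_eq_AE) (use rep in \<open>auto simp: AE_measure_pmf_iff represents_def\<close>)
  with rep show ?thesis
    by (intro exI[of _ "map_pmf rep D"]) (auto simp: prob_poly_def represents_def)
qed

text \<open>The product is \<open>0\<close> or \<open>V\<close> at the sum, according to the sampled
  threshold. Inside the window the threshold may go either way, so \<open>B\<close> is demanded of
  both values there. Leaving \<open>B\<close> arbitrary serves all three requirements by one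
  argument. The condition on \<open>m\<close> and \<open>w\<close> makes the sampling error at most
  \<open>2 * exp (- L)\<close> for a density deviation of \<open>w / (2 * n)\<close>; the threshold
  polynomial adds another \<open>exp (- L)\<close>.\<close>

lemma sampled_threshold_product:
  fixes L w t :: real and V :: "real poly"
  assumes n: "n \<ge> 1" and m: "m \<ge> 1" and L: "L \<ge> 1" and w: "w > 0" "2 * L * (real n)\<^sup>2 \<le> real m * w\<^sup>2"
    and d: "48 * sqrt (real m * L) + real (degree V) \<le> d"
  shows "\<exists>P. prob_poly n P \<and> prob_poly_degree_le P d \<and>
    (\<forall>x \<in> {1..n} \<rightarrow> {0, 1 :: real}. \<forall>B.
       ((\<Sum>i=1..n. x i) \<le> t - w \<longrightarrow> B 0) \<and>
       (t - w < (\<Sum>i=1..n. x i) \<and> (\<Sum>i=1..n. x i) \<le> t \<longrightarrow> B 0 \<and> B (poly V (\<Sum>i=1..n. x i))) \<and>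
       (t < (\<Sum>i=1..n. x i) \<longrightarrow> B (poly V (\<Sum>i=1..n. x i))) \<longrightarrow>
         1 - 3 * exp (- L) \<le> measure_pmf.prob P {p. B (eval_poly p x)})"
proof -
  from random_threshold[OF L, of m]
  obtain D :: "(real \<Rightarrow> (nat \<Rightarrow> real) \<Rightarrow> real) pmf" where
    D1: "\<And>F \<theta>. F \<in> set_pmf D \<Longrightarrow> \<exists>d. polyfun m d (F \<theta>) \<and> real d \<le> 48 * sqrt (real m * L)"
    and D2: "\<And>x. x \<in> {1..m} \<rightarrow> {0, 1} \<Longrightarrow>
     measure_pmf.prob D {F. \<not> (\<forall>\<theta>. F \<theta> x = of_bool (\<theta> < (\<Sum>i=1..m. x i)))} \<le> exp (- L)"
    by blast
  define b where "b = w / (2 * real n)"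
  \<comment> \<open>The cut is at the middle \<open>t - w / 2\<close> of the window, scaled to the
    sample, which leaves a margin of \<open>b\<close> in density on either side.\<close>
  define \<theta> where "\<theta> = real m * ((t - w / 2) / real n)"
  have b: "b > 0" using w n by (simp add: b_def)
  have Lb: "L \<le> 2 * real m * b\<^sup>2"
  proof -
    have "2 * real m * b\<^sup>2 = real m * w\<^sup>2 / (2 * (real n)\<^sup>2)"
      by (simp add: b_def power_divide power_mult_distrib)
    moreover have "0 < 2 * (real n)\<^sup>2" using n by simp
    ultimately show ?thesis using w(2) by (simp only: pos_le_divide_eq mult_ac)
  qed
  define G where "G \<sigma> F x = F \<theta> (\<lambda>i. x (\<sigma> i)) * poly V (\<Sum>i=1..n. x i)"
    for \<sigma> :: "nat \<Rightarrow> nat" and F :: "real \<Rightarrow> (nat \<Rightarrow> real) \<Rightarrow> real" and x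
  define E where "E = bind_pmf (sample_pmf m n) (\<lambda>\<sigma>. map_pmf (G \<sigma>) D)"
  have "polyfun n (nat \<lfloor>d\<rfloor>) f" if "f \<in> set_pmf E" for f
  proof -
    from that obtain \<sigma> F where \<sigma>: "\<sigma> \<in> set_pmf (sample_pmf m n)" and F: "F \<in> set_pmf D"
      and f: "f = G \<sigma> F" by (auto simp: E_def)
    from D1[OF F] obtain e where e: "polyfun m e (F \<theta>)" "real e \<le> 48 * sqrt (real m * L)" by blast
    have "polyfun n (e + degree V) f"
      unfolding f G_def[abs_def]
      by (intro polyfun.mult polyfun_subst[OF e(1)] polyfun_poly sample_pmf_range[OF n \<sigma>])
    moreover have "e + degree V \<le> nat \<lfloor>d\<rfloor>" using e(2) d by (simp add: le_nat_floor)
    ultimately show ?thesis by (rule polyfun.mono)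
  qed
  from realise_polyfun_pmf[OF this] obtain P where P: "prob_poly n P"
    "\<And>p. p \<in> set_pmf P \<Longrightarrow> total_degree p \<le> nat \<lfloor>d\<rfloor>"
    "\<And>x B. measure_pmf.prob P {p. B (eval_poly p x)} = measure_pmf.prob E {f. B (f x)}" by blast
  have "0 \<le> sqrt (real m * L)" using L by simp
  then have "d \<ge> 0" using d by linarith
  have "prob_poly_degree_le P d"
    unfolding prob_poly_degree_le_def
  proof
    fix p assume "p \<in> set_pmf P"
    then have "real (total_degree p) \<le> real (nat \<lfloor>d\<rfloor>)" using P(2) by simp
    also have "\<dots> \<le> d" using \<open>d \<ge> 0\<close> by simp
    finally show "real (total_degree p) \<le> d" .
  qed
  moreover have "measure_pmf.prob P {p. B (eval_poly p x)} \<ge> 1 - 3 * exp (- L)"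
    if x: "x \<in> {1..n} \<rightarrow> {0, 1 :: real}" and z: "z = (\<Sum>i=1..n. x i)"
      and B: "z \<le> t - w \<longrightarrow> B 0" "t - w < z \<and> z \<le> t \<longrightarrow> B 0 \<and> B (poly V z)" "t < z \<longrightarrow> B (poly V z)" for x z B
  proof -
    define bad where "bad \<sigma> \<longleftrightarrow> \<bar>(\<Sum>i=1..m. x (\<sigma> i)) / real m - z / real n\<bar> \<ge> b" for \<sigma>
    have "measure_pmf.prob E {f. \<not> B (f x)} \<le> 2 * exp (- 2 * real m * b\<^sup>2) + exp (- L)"
      unfolding E_def
    proof (rule prob_bind_pmf_le[where bad = bad])
      show "measure_pmf.prob (sample_pmf m n) {a. bad a} \<le> 2 * exp (- 2 * real m * b\<^sup>2)"
        unfolding bad_def z using b by (intro sample_pmf_Hoeffding[OF x n m]) simp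
      fix \<sigma> assume \<sigma>: "\<sigma> \<in> set_pmf (sample_pmf m n)" "\<not> bad \<sigma>"
      let ?x = "\<lambda>i. x (\<sigma> i)"
      let ?y = "\<Sum>i=1..m. ?x i"
      have x': "?x \<in> {1..m} \<rightarrow> {0, 1}" using x sample_pmf_range[OF n \<sigma>(1)] by (auto simp: Pi_iff)
      have G: "B (G \<sigma> F x)" if F: "\<forall>\<theta>. F \<theta> ?x = of_bool (\<theta> < ?y)" for F
      proof -
        have near: "\<bar>?y / real m - z / real n\<bar> < b" using \<sigma>(2) by (simp add: bad_def)
        have y: "\<theta> < ?y \<longleftrightarrow> t / real n - b < ?y / real m"
        proof -
          have "\<theta> = (t / real n - b) * real m" by (simp add: \<theta>_def b_def diff_divide_distrib)
          then show ?thesis using m by (simp add: pos_less_divide_eq)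
        qed
        have 1: "\<not> \<theta> < ?y" if "z \<le> t - w"
        proof -
          have "z / real n \<le> t / real n - 2 * b" using that n by (simp add: b_def field_simps)
          then show ?thesis unfolding y using near[unfolded abs_less_iff] by linarith
        qed
        have 2: "\<theta> < ?y" if "t < z"
        proof -
          have "t / real n < z / real n" using that n by (simp add: field_simps)
          then show ?thesis unfolding y using near[unfolded abs_less_iff] by linarith
        qed
        have "G \<sigma> F x = (if \<theta> < ?y then poly V z else 0)" using F by (simp add: G_def z)
        then show ?thesis using 1 2 B by (cases "z \<le> t - w"; cases "t < z") auto
      qed
      have "measure_pmf.prob (map_pmf (G \<sigma>) D) {f. \<not> B (f x)}
          = measure_pmf.prob D {F. \<not> B (G \<sigma> F x)}" by simp
      also have "\<dots> \<le> measure_pmf.prob D {F. \<not> (\<forall>\<theta>. F \<theta> ?x = of_bool (\<theta> < ?y))}"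
        by (rule measure_pmf.finite_measure_mono) (use G in blast, simp)
      also have "\<dots> \<le> exp (- L)" by (rule D2[OF x'])
      finally show "measure_pmf.prob (map_pmf (G \<sigma>) D) {f. \<not> B (f x)} \<le> exp (- L)" .
    qed simp
    also have "\<dots> \<le> 3 * exp (- L)" using Lb by simp
    finally have "measure_pmf.prob E {f. \<not> B (f x)} \<le> 3 * exp (- L)" .
    moreover have "measure_pmf.prob E {f. \<not> B (f x)} = 1 - measure_pmf.prob E {f. B (f x)}"
      using measure_pmf.prob_compl[of "{f. B (f x)}" E] by (simp add: Collect_neg_eq Compl_eq_Diff_UNIV)
    ultimately show ?thesis unfolding P(3) by linarith
  qed
  ultimately show ?thesis using P(1) by blast
qed

section \<open>Chebyshev polynomials\<close>

fun chebyshev :: "nat \<Rightarrow> real poly" where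
  "chebyshev 0 = 1"
| "chebyshev (Suc 0) = [:0, 1:]"
| "chebyshev (Suc (Suc n)) = [:0, 2:] * chebyshev (Suc n) - chebyshev n"

lemma degree_chebyshev: "degree (chebyshev n) \<le> n"
proof (induction n rule: chebyshev.induct)
  case (3 n)
  have "degree ([:0, 2:] * chebyshev (Suc n)) \<le> Suc (Suc n)"
    using degree_mult_le[of "[:0, 2:]" "chebyshev (Suc n)"] 3 by simp
  then show ?case unfolding chebyshev.simps using 3 by (intro degree_diff_le) auto
qed auto

lemma chebyshev_cos: "poly (chebyshev n) (cos u) = cos (real n * u)"
proof (induction n rule: chebyshev.induct)
  case (3 n)
  have "cos (real (Suc n) * u + u) + cos (real (Suc n) * u - u) = 2 * cos u * cos (real (Suc n) * u)"
    by (simp add: cos_add cos_diff)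
  moreover have "real (Suc n) * u + u = real (Suc (Suc n)) * u" "real (Suc n) * u - u = real n * u"
    by (simp_all add: algebra_simps)
  ultimately have "cos (real (Suc (Suc n)) * u) = 2 * cos u * cos (real (Suc n) * u) - cos (real n * u)"
    by simp
  then show ?case using 3 by simp
qed auto

text \<open>\<open>cosh\<close> satisfies the same addition identity as \<open>cos\<close>, so the
  recurrence carries over; this governs the growth to the right of 1.\<close>

lemma chebyshev_cosh: "poly (chebyshev n) (cosh u) = cosh (real n * u)"
proof (induction n rule: chebyshev.induct)
  case (3 n)
  have "cosh (real (Suc n) * u + u) + cosh (real (Suc n) * u - u) = 2 * cosh u * cosh (real (Suc n) * u)"
    by (simp add: cosh_add cosh_diff)
  moreover have "real (Suc n) * u + u = real (Suc (Suc n)) * u" "real (Suc n) * u - u = real n * u"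
    by (simp_all add: algebra_simps)
  ultimately have "cosh (real (Suc (Suc n)) * u) = 2 * cosh u * cosh (real (Suc n) * u) - cosh (real n * u)"
    by simp
  then show ?case using 3 by simp
qed auto

lemma abs_chebyshev_le_1: "\<bar>y\<bar> \<le> 1 \<Longrightarrow> \<bar>poly (chebyshev n) y\<bar> \<le> 1"
  using chebyshev_cos[of n "arccos y"] cos_arccos_abs[of y] by simp

lemma chebyshev_gt_1:
  assumes "y > 1" "n > 0"
  shows "poly (chebyshev n) y > 1"
proof -
  have y: "y = cosh (arcosh y)" using assms by simp
  have "arcosh y \<noteq> 0" using assms by simp
  then have "cosh (real n * arcosh y) \<noteq> 1" using assms by simp
  then have "cosh (real n * arcosh y) > 1"
    using cosh_real_ge_1[of "real n * arcosh y"] by linarith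
  then show ?thesis using chebyshev_cosh[of n "arcosh y"] y by simp
qed

text \<open>Monotonicity of \<open>cosh\<close> avoids computing \<open>arcosh y\<close>: any
  nonnegative \<open>u\<close> below it yields a lower bound.\<close>

lemma chebyshev_ge_cosh:
  assumes "0 \<le> u" "cosh u \<le> y"
  shows "poly (chebyshev n) y \<ge> cosh (real n * u)"
proof -
  have y: "y \<ge> 1" using assms cosh_real_ge_1[of u] by linarith
  then have "u \<le> arcosh y"
    using assms cosh_real_nonneg_le_iff[of u "arcosh y"] by simp
  then have "cosh (real n * u) \<le> cosh (real n * arcosh y)"
    using assms y by (subst cosh_real_nonneg_le_iff) (auto intro: mult_left_mono)
  then show ?thesis using chebyshev_cosh[of n "arcosh y"] y by simp
qed

lemma cosh_le_quadratic:
  fixes u :: real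
  assumes "0 \<le> u" "u \<le> 1"
  shows "cosh u \<le> 1 + u\<^sup>2"
proof -
  have 1: "exp u \<le> 1 + u + u\<^sup>2" using assms by (rule exp_bound)
  \<comment> \<open>The product equals \<open>1 + u ^ 3\<close>.\<close>
  have "1 \<le> (1 - u + u\<^sup>2) * (1 + u)"
    using assms by (simp add: power2_eq_square algebra_simps)
  also have "\<dots> \<le> (1 - u + u\<^sup>2) * exp u"
    using assms by (intro mult_left_mono exp_ge_add_one_self) auto
  finally have "exp (- u) \<le> 1 - u + u\<^sup>2" by (simp add: exp_minus field_simps)
  with 1 show ?thesis by (simp add: cosh_field_def)
qed

text \<open>An affine map carries the window onto the interval from -1 to 1. An excess of
  \<open>w * u\<^sup>2 / 2\<close> over \<open>t\<close> becomes an excess of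
  \<open>u\<^sup>2\<close> over 1, which reaches \<open>cosh u\<close>, so the value is at least
  \<open>cosh (d * u)\<close>.\<close>

lemma chebyshev_threshold_poly:
  fixes t w :: real
  assumes "w > 0" "d > 0"
  shows "\<exists>V :: real poly. degree V \<le> d \<and> (\<forall>z. t - w \<le> z \<and> z \<le> t \<longrightarrow> \<bar>poly V z\<bar> \<le> 1) \<and>
           (\<forall>z>t. poly V z > 1) \<and>
           (\<forall>u z. 0 \<le> u \<and> u \<le> 1 \<and> t + w * u\<^sup>2 / 2 \<le> z \<longrightarrow> poly V z \<ge> exp (real d * u) / 2)"
proof -
  define V where "V = pcompose (chebyshev d) [:1 - 2 * t / w, 2 / w:]"
  have V: "poly V z = poly (chebyshev d) (1 + 2 * (z - t) / w)" for z
    using assms(1) by (simp add: V_def poly_pcompose field_simps)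
  have "degree V \<le> d"
    using degree_chebyshev[of d] assms(1) by (simp add: V_def degree_pcompose)
  moreover have "\<bar>poly V z\<bar> \<le> 1" if "t - w \<le> z" "z \<le> t" for z
    unfolding V using that assms(1)
    by (intro abs_chebyshev_le_1) (auto simp: abs_le_iff field_simps)
  moreover have "poly V z > 1" if "z > t" for z
    unfolding V using that assms by (intro chebyshev_gt_1) auto
  moreover have "poly V z \<ge> exp (real d * u) / 2" if "0 \<le> u" "u \<le> 1" "t + w * u\<^sup>2 / 2 \<le> z" for u z
  proof -
    have "exp (real d * u) / 2 \<le> cosh (real d * u)" by (simp add: cosh_field_def)
    also have "\<dots> \<le> poly V z" unfolding V
    proof (rule chebyshev_ge_cosh)
      have "u\<^sup>2 \<le> 2 * (z - t) / w"
        using that(3) assms(1) by (simp add: field_simps)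
      then show "cosh u \<le> 1 + 2 * (z - t) / w"
        using cosh_le_quadratic[OF that(1,2)] by linarith
    qed (use that in auto)
    finally show ?thesis .
  qed
  ultimately show ?thesis by blast
qed

section \<open>Discrete Chebyshev polynomials\<close>

definition binomial_poly :: "nat \<Rightarrow> real poly" where
  "binomial_poly j = smult (1 / fact j) (\<Prod>i<j. [:- real i, 1:])"

lemma poly_binomial_poly [simp]: "poly (binomial_poly j) x = x gchoose j"
  by (simp add: binomial_poly_def poly_prod gbinomial_prod_rev atLeast0LessThan)

lemma degree_binomial_poly [simp]: "degree (binomial_poly j) = j"
proof -
  have "degree (\<Prod>i<j. [:- real i, 1:]) = (\<Sum>i<j. degree [:- real i, 1:])"
    by (intro degree_prod_eq_sum_degree) auto
  then show ?thesis by (simp add: binomial_poly_def)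
qed

lemma coeff_binomial_poly [simp]: "coeff (binomial_poly j) j = 1 / fact j"
proof -
  have "degree (\<Prod>i<j. [:- real i, 1:]) = j"
    by (subst degree_prod_eq_sum_degree) auto
  then have "coeff (\<Prod>i<j. [:- real i, 1:]) j = lead_coeff (\<Prod>i<j. [:- real i, 1:])" by simp
  also have "\<dots> = 1" by (simp add: lead_coeff_prod)
  finally show ?thesis by (simp add: binomial_poly_def)
qed

lemma binomial_poly_nonzero [simp]: "binomial_poly j \<noteq> 0"
proof
  assume "binomial_poly j = 0"
  then have "coeff (binomial_poly j) j = 0" by simp
  then show False unfolding coeff_binomial_poly by simp
qed

text \<open>Subtracting the right multiple of the top basis element, whose leading coefficient is
  \<open>1 / fact q\<close>, lowers the degree. Only the top coefficient is recorded, since finite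
  differences and orthogonality will kill the other terms.\<close>

lemma binomial_poly_expansion:
  assumes "degree p \<le> q"
  shows "\<exists>a. p = (\<Sum>j\<le>q. smult (a j) (binomial_poly j)) \<and> a q = fact q * coeff p q"
  using assms
proof (induction q arbitrary: p)
  case 0
  then obtain c where c: "p = [:c:]" by (auto dest: degree_eq_zeroE)
  have "p = smult c (binomial_poly 0)" by (simp add: binomial_poly_def c)
  then show ?case using c by (intro exI[of _ "\<lambda>_. c"]) simp
next
  case (Suc q)
  define b where "b = fact (Suc q) * coeff p (Suc q)"
  define r where "r = p - smult b (binomial_poly (Suc q))"
  have c: "coeff r (Suc q) = 0"
    unfolding r_def b_def coeff_diff coeff_smult coeff_binomial_poly by simp
  have "degree r \<le> Suc q" unfolding r_def using Suc.prems
    by (intro degree_diff_le) (auto intro: order_trans[OF degree_smult_le])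
  with c have "degree r \<le> q"
    by (metis degree_0 le_SucE leading_coeff_0_iff zero_le)
  with Suc.IH obtain a where a: "r = (\<Sum>j\<le>q. smult (a j) (binomial_poly j))" by blast
  have "p = (\<Sum>j\<le>Suc q. smult ((a(Suc q := b)) j) (binomial_poly j))"
    using a by (simp add: r_def algebra_simps)
  then show ?case by (intro exI[of _ "a(Suc q := b)"]) (simp add: b_def)
qed

text \<open>Trinomial revision pulls out \<open>q choose j\<close> and leaves the alternating sum of
  row \<open>q - j\<close> of Pascal's triangle, which vanishes unless the row is 0.\<close>

lemma alternating_sum_binomial:
  assumes "j \<le> q"
  shows "(\<Sum>i\<le>q. (-1) ^ i * real (q choose i) * real (i choose j)) = (if j = q then (-1) ^ q else 0)"
proof -
  have "(\<Sum>i\<le>q. (-1) ^ i * real (q choose i) * real (i choose j))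
      = (\<Sum>i\<in>{j..q}. (-1) ^ i * real (q choose i) * real (i choose j))"
    by (intro sum.mono_neutral_right) auto
  also have "\<dots> = (\<Sum>i\<in>{j..q}. (-1) ^ i * (real (q choose j) * real ((q - j) choose (i - j))))"
  proof (intro sum.cong refl)
    fix i assume "i \<in> {j..q}"
    then have "(q choose i) * (i choose j) = (q choose j) * ((q - j) choose (i - j))"
      by (intro choose_mult) auto
    then have "real (q choose i) * real (i choose j) = real (q choose j) * real ((q - j) choose (i - j))"
      by (metis of_nat_mult)
    then show "(-1) ^ i * real (q choose i) * real (i choose j)
        = (-1) ^ i * (real (q choose j) * real ((q - j) choose (i - j)))"
      by (simp add: mult.assoc)
  qed
  also have "\<dots> = (\<Sum>i\<le>q - j. (-1) ^ (i + j) * (real (q choose j) * real ((q - j) choose i)))"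
    by (rule sum.reindex_bij_witness[of _ "\<lambda>i. i + j" "\<lambda>i. i - j"]) (use assms in auto)
  also have "\<dots> = (-1) ^ j * real (q choose j) * (\<Sum>i\<le>q - j. (-1) ^ i * real ((q - j) choose i))"
    by (simp add: sum_distrib_left power_add mult_ac)
  also have "\<dots> = (if j = q then (-1) ^ q else 0)"
    using choose_alternating_sum[of "q - j", where 'a = real] assms by (cases "j = q") auto
  finally show ?thesis .
qed

text \<open>Up to sign this is the \<open>q\<close>-th finite difference at 0, which sees only the
  coefficient of degree \<open>q\<close>.\<close>

lemma alternating_sum_poly:
  fixes p :: "real poly"
  assumes "degree p \<le> q"
  shows "(\<Sum>i\<le>q. (-1) ^ i * real (q choose i) * poly p (real i)) = (-1) ^ q * fact q * coeff p q"
proof -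
  from binomial_poly_expansion[OF assms] obtain a where
    a: "p = (\<Sum>j\<le>q. smult (a j) (binomial_poly j))" "a q = fact q * coeff p q" by blast
  have "(\<Sum>i\<le>q. (-1) ^ i * real (q choose i) * poly p (real i))
     = (\<Sum>i\<le>q. \<Sum>j\<le>q. a j * ((-1) ^ i * real (q choose i) * real (i choose j)))"
    by (subst a(1)) (simp add: poly_sum sum_distrib_left binomial_gbinomial mult_ac)
  also have "\<dots> = (\<Sum>j\<le>q. a j * (\<Sum>i\<le>q. (-1) ^ i * real (q choose i) * real (i choose j)))"
    by (subst sum.swap) (simp add: sum_distrib_left)
  also have "\<dots> = (\<Sum>j\<le>q. if j = q then a j * (-1) ^ q else 0)"
    by (intro sum.cong refl) (simp add: alternating_sum_binomial)
  also have "\<dots> = (-1) ^ q * fact q * coeff p q" by (simp add: a(2) mult_ac)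
  finally show ?thesis .
qed

section \<open>Binomial identities for the orthogonality computation\<close>

text \<open>Combinatorially, subsets of size \<open>a + b + 1\<close> are sorted by the position
  \<open>x\<close> of their element number \<open>b + 1\<close>. The proof applies Pascal's rule to
  the first factor, starting from the hockey-stick sum for \<open>a = 0\<close>.\<close>

lemma sum_binomial_convolution:
  "(\<Sum>x<N. ((N - 1 - x) choose a) * (x choose b)) = N choose (a + b + 1)"
proof (induction N arbitrary: a)
  case 0
  show ?case by simp
next
  case (Suc N)
  show ?case
  proof (cases a)
    case 0
    have "(\<Sum>x<Suc N. x choose b) = Suc N choose Suc b"
      using sum_choose_upper[of b N] by (simp add: lessThan_Suc_atMost)
    then show ?thesis using 0 by simp
  next
    case (Suc a')
    have "(\<Sum>x<Suc N. ((Suc N - 1 - x) choose a) * (x choose b))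
        = (\<Sum>x<N. ((N - x) choose Suc a') * (x choose b))" using Suc by simp
    also have "\<dots> = (\<Sum>x<N. ((N - 1 - x) choose a') * (x choose b) + ((N - 1 - x) choose Suc a') * (x choose b))"
    proof (intro sum.cong refl)
      fix x assume "x \<in> {..<N}"
      then have "N - x = Suc (N - 1 - x)" by auto
      then show "((N - x) choose Suc a') * (x choose b)
          = ((N - 1 - x) choose a') * (x choose b) + ((N - 1 - x) choose Suc a') * (x choose b)"
        by (simp add: algebra_simps)
    qed
    also have "\<dots> = (N choose (a' + b + 1)) + (N choose (Suc a' + b + 1))"
      by (simp only: sum.distrib Suc.IH)
    finally show ?thesis using Suc by simp
  qed
qed

text \<open>Linearises a product in the binomial basis: Vandermonde for
  \<open>x = (x - i) + i\<close>, then trinomial revision.\<close>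

lemma binomial_mult_expansion:
  "(x choose i) * (x choose j) = (\<Sum>k\<le>j. (i choose (j - k)) * ((i + k) choose k) * (x choose (i + k)))"
proof (cases "i \<le> x")
  case True
  have "x choose j = (\<Sum>k\<le>j. ((x - i) choose k) * (i choose (j - k)))"
    using vandermonde[of "x - i" i j] True by simp
  then have "(x choose i) * (x choose j) = (\<Sum>k\<le>j. (i choose (j - k)) * ((x choose i) * ((x - i) choose k)))"
    by (simp add: sum_distrib_left mult_ac)
  also have "\<dots> = (\<Sum>k\<le>j. (i choose (j - k)) * (((i + k) choose k) * (x choose (i + k))))"
  proof (rule sum.cong[OF refl], rule arg_cong2[of _ _ _ _ "(*)", OF refl])
    fix k
    show "(x choose i) * ((x - i) choose k) = ((i + k) choose k) * (x choose (i + k))"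
    proof (cases "i + k \<le> x")
      case True
      then have "(x choose (i + k)) * ((i + k) choose i) = (x choose i) * ((x - i) choose (i + k - i))"
        by (intro choose_mult) auto
      moreover have "(i + k) choose i = (i + k) choose k"
        using binomial_symmetric[of i "i + k"] by simp
      ultimately show ?thesis by (simp add: mult_ac)
    next
      case False
      then show ?thesis by (auto simp: binomial_eq_0)
    qed
  qed
  finally show ?thesis by (simp add: mult.assoc)
qed (auto simp: binomial_eq_0)

text \<open>The discrete Chebyshev (Gram) polynomial of degree \<open>q\<close>, up to normalisation: it is orthogonal
  to all polynomials of smaller degree with respect to counting measure on \<open>{0, \<dots>, N - 1}\<close>.\<close>

definition gram_poly :: "nat \<Rightarrow> nat \<Rightarrow> real poly" where
  "gram_poly N q = (\<Sum>i\<le>q. smult ((-1) ^ i * real (q choose i))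
     (pcompose (binomial_poly (q - i)) [:real N - 1, -1:] * binomial_poly i))"

lemma poly_gram_poly:
  "poly (gram_poly N q) x =
     (\<Sum>i\<le>q. (-1) ^ i * real (q choose i) * ((real N - 1 - x) gchoose (q - i)) * (x gchoose i))"
  by (simp add: gram_poly_def poly_sum poly_pcompose mult_ac)

lemma poly_gram_poly_nat:
  assumes "x < N"
  shows "poly (gram_poly N q) (real x) =
     (\<Sum>i\<le>q. (-1) ^ i * real (q choose i) * real ((N - 1 - x) choose (q - i)) * real (x choose i))"
proof -
  have "real N - 1 - real x = real (N - 1 - x)" using assms by (simp add: of_nat_diff)
  then show ?thesis unfolding poly_gram_poly by (simp add: binomial_gbinomial)
qed

lemma degree_gram_poly: "degree (gram_poly N q) \<le> q"
proof -
  have "degree (pcompose (binomial_poly (q - i)) [:real N - 1, -1:] * binomial_poly i) \<le> q" if "i \<le> q" for i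
    using degree_mult_le[of "pcompose (binomial_poly (q - i)) [:real N - 1, -1:]" "binomial_poly i"] that
    by (simp add: degree_pcompose)
  then show ?thesis unfolding gram_poly_def
    by (intro degree_sum_le) (auto intro: order_trans[OF degree_smult_le])
qed

text \<open>The reflected factor contributes the sign \<open>(-1) ^ (q - i)\<close>, which completes
  \<open>(-1) ^ i\<close> to a common sign; what is left is the sum of the squares of
  \<open>q choose i\<close>.\<close>

lemma coeff_gram_poly: "fact q * coeff (gram_poly N q) q = (-1) ^ q * real ((2 * q) choose q)"
proof -
  have c: "coeff (pcompose (binomial_poly (q - i)) [:real N - 1, -1:] * binomial_poly i) q
      = (-1) ^ (q - i) / (fact (q - i) * fact i)" if "i \<le> q" for i
  proof -
    let ?P = "pcompose (binomial_poly (q - i)) [:real N - 1, -1:]"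
    have d: "degree ?P = q - i" by (simp add: degree_pcompose)
    have l: "lead_coeff ?P = (-1) ^ (q - i) / fact (q - i)"
      by (subst lead_coeff_comp) auto
    have "coeff (?P * binomial_poly i) (degree ?P + degree (binomial_poly i))
        = lead_coeff ?P * lead_coeff (binomial_poly i)"
      by (rule coeff_mult_degree_sum)
    then show ?thesis using that by (simp add: d l[unfolded d])
  qed
  have "fact q * coeff (gram_poly N q) q
      = (\<Sum>i\<le>q. fact q * ((-1) ^ i * real (q choose i) * ((-1) ^ (q - i) / (fact (q - i) * fact i))))"
    by (simp add: gram_poly_def coeff_sum c sum_distrib_left)
  also have "\<dots> = (\<Sum>i\<le>q. (-1) ^ q * real ((q choose i)\<^sup>2))"
  proof (intro sum.cong refl)
    fix i assume "i \<in> {..q}"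
    then have i: "i \<le> q" by simp
    have "real (q choose i) = fact q / (fact i * fact (q - i))" using i by (rule binomial_fact)
    moreover have "(-1::real) ^ q = (-1) ^ i * (-1) ^ (q - i)" using i by (simp add: power_add[symmetric])
    ultimately show "fact q * ((-1) ^ i * real (q choose i) * ((-1) ^ (q - i) / (fact (q - i) * fact i)))
        = (-1) ^ q * real ((q choose i)\<^sup>2)"
      by (simp add: power2_eq_square mult_ac)
  qed
  also have "\<dots> = (-1) ^ q * real ((2 * q) choose q)"
    by (simp add: sum_distrib_left[symmetric] choose_square_sum[symmetric])
  finally show ?thesis .
qed

section \<open>Orthogonality and norm of the Gram polynomials\<close>

text \<open>After linearisation, summing over \<open>x\<close> by convolution gives
  \<open>N choose (q + k + 1)\<close>, which does not depend on \<open>i\<close>. The sum over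
  \<open>i\<close> is then a finite difference of order \<open>q\<close> of a polynomial of degree
  \<open>j\<close>. For \<open>j = q\<close> Vandermonde collects the rest.\<close>

lemma gram_poly_inner_binomial:
  assumes "j \<le> q"
  shows "(\<Sum>x<N. poly (gram_poly N q) (real x) * real (x choose j))
       = (if j = q then (-1) ^ q * real ((N + q) choose (2 * q + 1)) else 0)"
proof -
  define c :: "nat \<Rightarrow> nat \<Rightarrow> real"
    where "c i k = (-1) ^ i * real (q choose i) * (real (i choose (j - k)) * real ((i + k) choose k))" for i k
  have "(\<Sum>x<N. poly (gram_poly N q) (real x) * real (x choose j))
     = (\<Sum>x<N. \<Sum>i\<le>q. (-1) ^ i * real (q choose i) * real ((N - 1 - x) choose (q - i))
           * real ((x choose i) * (x choose j)))"
    by (simp add: poly_gram_poly_nat sum_distrib_right sum_distrib_left mult_ac)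
  also have "\<dots> = (\<Sum>x<N. \<Sum>i\<le>q. \<Sum>k\<le>j. c i k * real (((N - 1 - x) choose (q - i)) * (x choose (i + k))))"
    unfolding binomial_mult_expansion
    by (simp add: c_def sum_distrib_left mult_ac)
  also have "\<dots> = (\<Sum>i\<le>q. \<Sum>x<N. \<Sum>k\<le>j. c i k * real (((N - 1 - x) choose (q - i)) * (x choose (i + k))))"
    by (rule sum.swap)
  also have "\<dots> = (\<Sum>i\<le>q. \<Sum>k\<le>j. \<Sum>x<N. c i k * real (((N - 1 - x) choose (q - i)) * (x choose (i + k))))"
    by (intro sum.cong refl sum.swap)
  also have "\<dots> = (\<Sum>i\<le>q. \<Sum>k\<le>j. c i k * real (N choose (q + k + 1)))"
  proof (intro sum.cong refl)
    fix i k assume "i \<in> {..q}"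
    then show "(\<Sum>x<N. c i k * real (((N - 1 - x) choose (q - i)) * (x choose (i + k))))
        = c i k * real (N choose (q + k + 1))"
      unfolding sum_distrib_left[symmetric] of_nat_sum[symmetric] sum_binomial_convolution by simp
  qed
  also have "\<dots> = (\<Sum>k\<le>j. (\<Sum>i\<le>q. c i k) * real (N choose (q + k + 1)))"
    by (subst sum.swap) (simp add: sum_distrib_right)
  also have "\<dots> = (\<Sum>k\<le>j. (if j = q then (-1) ^ q * real (q choose k) else 0) * real (N choose (q + k + 1)))"
  proof (intro sum.cong refl arg_cong2[of _ _ _ _ "(*)"])
    fix k assume "k \<in> {..j}"
    then have k: "k \<le> j" by simp
    \<comment> \<open>The factor of \<open>c i k\<close> besides sign and \<open>q choose i\<close>,
      read as a polynomial in \<open>i\<close>.\<close>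
    define p where "p = binomial_poly (j - k) * pcompose (binomial_poly k) [:real k, 1:]"
    have "degree p = j"
      unfolding p_def using k pcompose_eq_0[of "binomial_poly k" "[:real k, 1:]"]
      by (subst degree_mult_eq) (auto simp: degree_pcompose)
    have lc: "lead_coeff p = 1 / (fact (j - k) * fact k)"
      unfolding p_def lead_coeff_mult by (subst lead_coeff_comp) auto
    have "(\<Sum>i\<le>q. c i k) = (\<Sum>i\<le>q. (-1) ^ i * real (q choose i) * poly p (real i))"
      by (simp add: c_def p_def poly_pcompose binomial_gbinomial add.commute)
    also have "\<dots> = (-1) ^ q * fact q * coeff p q"
      using assms \<open>degree p = j\<close> by (intro alternating_sum_poly) simp
    also have "\<dots> = (if j = q then (-1) ^ q * real (q choose k) else 0)"
    proof (cases "j = q")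
      case True
      then have "coeff p q = 1 / (fact (q - k) * fact k)" using lc \<open>degree p = j\<close> by simp
      then show ?thesis using True k by (simp add: binomial_fact)
    next
      case False
      then show ?thesis using assms \<open>degree p = j\<close> by (simp add: coeff_eq_0)
    qed
    finally show "(\<Sum>i\<le>q. c i k) = (if j = q then (-1) ^ q * real (q choose k) else 0)" .
  qed
  also have "\<dots> = (if j = q then (-1) ^ q * real ((N + q) choose (2 * q + 1)) else 0)"
  proof (cases "j = q")
    case True
    have "(N + q) choose (2 * q + 1) = (\<Sum>k\<le>2 * q + 1. (q choose k) * (N choose (2 * q + 1 - k)))"
      by (subst vandermonde) (simp add: add.commute)
    also have "\<dots> = (\<Sum>k\<le>q. (q choose k) * (N choose (2 * q + 1 - k)))"
      by (intro sum.mono_neutral_right) auto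
    also have "\<dots> = (\<Sum>k\<le>q. (q choose k) * (N choose (q + k + 1)))"
    proof (rule sum.reindex_bij_witness[of _ "\<lambda>k. q - k" "\<lambda>k. q - k"])
      fix k assume "k \<in> {..q}"
      then have "k \<le> q" by simp
      then show "(q choose (q - k)) * (N choose (q + (q - k) + 1)) = (q choose k) * (N choose (2 * q + 1 - k))"
        using binomial_symmetric[of k q] by (simp add: mult_2 Suc_diff_le)
    qed auto
    finally show ?thesis using True by (simp add: sum_distrib_left mult_ac)
  qed auto
  finally show ?thesis .
qed

text \<open>Expanding one of the two factors in the binomial basis, orthogonality leaves the top
  term only, and the signs cancel.\<close>

lemma gram_poly_sum_squares:
  "(\<Sum>x<N. (poly (gram_poly N q) (real x))\<^sup>2)
     = real ((2 * q) choose q) * real ((N + q) choose (2 * q + 1))"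
proof -
  from binomial_poly_expansion[OF degree_gram_poly] obtain a where
    a: "gram_poly N q = (\<Sum>j\<le>q. smult (a j) (binomial_poly j))"
       "a q = fact q * coeff (gram_poly N q) q" by blast
  have "poly (gram_poly N q) (real x) = (\<Sum>j\<le>q. a j * real (x choose j))" for x
    by (subst a(1)) (simp add: poly_sum binomial_gbinomial)
  then have "(poly (gram_poly N q) (real x))\<^sup>2
      = (\<Sum>j\<le>q. a j * (poly (gram_poly N q) (real x) * real (x choose j)))" for x
    unfolding power2_eq_square mult.left_commute[of "a _"] sum_distrib_left[symmetric] by simp
  then have "(\<Sum>x<N. (poly (gram_poly N q) (real x))\<^sup>2)
      = (\<Sum>x<N. \<Sum>j\<le>q. a j * (poly (gram_poly N q) (real x) * real (x choose j)))" by simp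
  also have "\<dots> = (\<Sum>j\<le>q. a j * (\<Sum>x<N. poly (gram_poly N q) (real x) * real (x choose j)))"
    by (subst sum.swap) (simp add: sum_distrib_left)
  also have "\<dots> = (\<Sum>j\<le>q. if j = q then a j * ((-1) ^ q * real ((N + q) choose (2 * q + 1))) else 0)"
    by (intro sum.cong refl) (simp add: gram_poly_inner_binomial)
  also have "\<dots> = real ((2 * q) choose q) * real ((N + q) choose (2 * q + 1))"
    by (cases "even q") (simp_all add: a(2) coeff_gram_poly)
  finally show ?thesis .
qed

section \<open>Size of the Gram polynomials on and off the grid\<close>

text \<open>The left side is the product of \<open>N + i\<close> over all integers \<open>i\<close>
  from \<open>-q\<close> to \<open>q\<close>; pairing \<open>i\<close> with \<open>-i\<close> gives
  factors \<open>N\<^sup>2 - i\<^sup>2\<close>.\<close>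

lemma binomial_fact_le_power: "((N + q) choose (2 * q + 1)) * fact (2 * q + 1) \<le> N ^ (2 * q + 1)"
proof (induction q)
  case 0
  show ?case by simp
next
  case (Suc q)
  let ?B = "(N + q) choose (2 * q + 1)"
  have 1: "Suc (2 * q + 2) * (Suc (N + q) choose Suc (2 * q + 2)) = Suc (N + q) * ((N + q) choose (2 * q + 2))"
    by (rule Suc_times_binomial)
  have 2: "Suc (2 * q + 1) * ((N + q) choose Suc (2 * q + 1)) = ?B * ((N + q) - (2 * q + 1))"
    by (metis Suc_eq_plus1 binomial_absorb_comp binomial_absorption mult.commute)
  have e: "N + Suc q = Suc (N + q)" "2 * Suc q + 1 = Suc (2 * q + 2)" by simp_all
  have "fact (2 * q + 2) = (2 * q + 2) * fact (2 * q + 1 :: nat)" by (simp add: fact_reduce)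
  then have "((N + Suc q) choose (2 * Suc q + 1)) * fact (2 * Suc q + 1)
      = (Suc (2 * q + 2) * (Suc (N + q) choose Suc (2 * q + 2))) * (2 * q + 2) * fact (2 * q + 1)"
    unfolding e by (simp only: fact_Suc mult_ac of_nat_id)
  also have "\<dots> = Suc (N + q) * (Suc (2 * q + 1) * ((N + q) choose Suc (2 * q + 1))) * fact (2 * q + 1)"
    unfolding 1 by (simp only: mult_ac Suc_eq_plus1 add_2_eq_Suc' add_Suc_right)
  also have "\<dots> = (Suc (N + q) * ((N + q) - (2 * q + 1))) * (?B * fact (2 * q + 1))"
    unfolding 2 by (simp only: mult_ac)
  also have "\<dots> \<le> (N * N) * N ^ (2 * q + 1)"
  proof (rule mult_mono[OF _ Suc.IH])
    \<comment> \<open>The new pair of factors is \<open>N + (q + 1)\<close> and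
      \<open>N - (q + 1)\<close>; for \<open>q + 1 > N\<close> the truncated difference is
      0.\<close>
    show "Suc (N + q) * ((N + q) - (2 * q + 1)) \<le> N * N"
    proof (cases "q + 1 \<le> N")
      case True
      then obtain d where "N = q + 1 + d" by (metis le_Suc_ex)
      then show ?thesis by (simp add: algebra_simps)
    qed auto
  qed auto
  also have "\<dots> = N ^ (2 * Suc q + 1)" by (simp add: mult_ac)
  finally show ?case .
qed

text \<open>One squared value is at most the whole sum of squares, and
  \<open>(fact q)\<^sup>2\<close> times the central binomial coefficient is
  \<open>fact (2 * q)\<close>.\<close>

lemma abs_gram_poly_le:
  assumes "x < N"
  shows "fact q * \<bar>poly (gram_poly N q) (real x)\<bar> \<le> real N ^ q * sqrt (real N)"
proof -
  let ?g = "poly (gram_poly N q) (real x)"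
  have "?g\<^sup>2 \<le> (\<Sum>x<N. (poly (gram_poly N q) (real x))\<^sup>2)"
    using assms by (intro member_le_sum) auto
  also have "\<dots> = real ((2 * q) choose q) * real ((N + q) choose (2 * q + 1))"
    by (rule gram_poly_sum_squares)
  finally have "(fact q * ?g)\<^sup>2 \<le> (fact q)\<^sup>2 * (real ((2 * q) choose q) * real ((N + q) choose (2 * q + 1)))"
    by (simp add: power_mult_distrib mult_left_mono)
  also have "\<dots> = fact (2 * q) * real ((N + q) choose (2 * q + 1))"
    using binomial_fact[of q "2 * q", where 'a = real] by (simp add: power2_eq_square mult_2)
  also have "\<dots> \<le> fact (2 * q + 1) * real ((N + q) choose (2 * q + 1))"
    by (intro mult_right_mono fact_mono) auto
  also have "\<dots> = real (((N + q) choose (2 * q + 1)) * fact (2 * q + 1))"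
    by (simp only: of_nat_mult of_nat_fact mult.commute)
  also have "\<dots> \<le> real (N ^ (2 * q + 1))"
    by (intro of_nat_mono binomial_fact_le_power)
  also have "\<dots> = (real N ^ q * sqrt (real N))\<^sup>2"
    by (simp add: power_mult_distrib power_mult[symmetric] mult.commute)
  finally have "\<bar>fact q * ?g\<bar> \<le> real N ^ q * sqrt (real N)"
    by (metis abs_le_square_iff abs_of_nonneg mult_nonneg_nonneg of_nat_0_le_iff real_sqrt_ge_zero zero_le_power)
  then show ?thesis by (simp add: abs_mult)
qed

text \<open>At negative integers the signs of the generalised binomials cancel the alternating ones,
  so all terms are nonnegative. Each is smallest at \<open>y = 1\<close>, where the sum is
  Vandermonde's.\<close>

lemma gram_poly_negative_ge:
  assumes "y \<ge> 1"
  shows "real ((N + q) choose q) \<le> poly (gram_poly N q) (- real y)"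
proof -
  have "poly (gram_poly N q) (- real y)
      = (\<Sum>i\<le>q. real (q choose i) * real ((N + (y - 1)) choose (q - i)) * real ((y + i - 1) choose i))"
    unfolding poly_gram_poly
  proof (intro sum.cong refl)
    fix i
    have "(- real y) gchoose i = (-1) ^ i * ((real y + real i - 1) gchoose i)"
      by (rule gbinomial_minus)
    also have "real y + real i - 1 = real (y + i - 1)" using assms by (simp add: of_nat_diff)
    finally have 1: "(- real y) gchoose i = (-1) ^ i * real ((y + i - 1) choose i)"
      by (simp add: binomial_gbinomial)
    have "real N - 1 - (- real y) = real (N + (y - 1))" using assms by (simp add: of_nat_diff)
    then have 2: "(real N - 1 - (- real y)) gchoose (q - i) = real ((N + (y - 1)) choose (q - i))"
      by (simp only: binomial_gbinomial)
    show "(-1) ^ i * real (q choose i) * ((real N - 1 - (- real y)) gchoose (q - i)) * ((- real y) gchoose i)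
       = real (q choose i) * real ((N + (y - 1)) choose (q - i)) * real ((y + i - 1) choose i)"
      unfolding 1 2 by (cases "even i") simp_all
  qed
  moreover have "real ((N + q) choose q) = (\<Sum>i\<le>q. real (q choose i) * real (N choose (q - i)) * 1)"
  proof -
    have "(N + q) choose q = (\<Sum>i\<le>q. (q choose i) * (N choose (q - i)))"
      by (subst vandermonde) (simp add: add.commute)
    then show ?thesis by simp
  qed
  moreover have "(\<Sum>i\<le>q. real (q choose i) * real (N choose (q - i)) * 1)
      \<le> (\<Sum>i\<le>q. real (q choose i) * real ((N + (y - 1)) choose (q - i)) * real ((y + i - 1) choose i))"
  proof (intro sum_mono mult_mono)
    fix i
    have "0 < (y + i - 1) choose i" using assms by (intro zero_less_binomial) auto
    then show "1 \<le> real ((y + i - 1) choose i)" by linarith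
  qed (auto intro: binomial_right_mono)
  ultimately show ?thesis by linarith
qed

lemma exp_half_le: 
  fixes y :: real
  assumes "0 \<le> y" "y \<le> 1"
  shows "exp (y / 2) \<le> 1 + y"
proof -
  have "exp (y / 2) \<le> 1 + y / 2 + (y / 2)\<^sup>2" using assms by (intro exp_bound) auto
  also have "(y / 2)\<^sup>2 \<le> y / 2"
    using mult_left_mono[OF assms(2) assms(1)] assms by (simp add: power2_eq_square)
  finally show ?thesis by simp
qed

text \<open>The right side is the product of \<open>N + i\<close> for \<open>i = 1, ..., q\<close>,
  and \<open>1 + i / N \<ge> exp (i / (2 * N))\<close> since \<open>i \<le> N\<close>.\<close>

lemma binomial_growth:
  assumes "q \<le> N" "N > 0"
  shows "real N ^ q * exp (real (q * (q + 1)) / (4 * real N)) \<le> fact q * real ((N + q) choose q)"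
  using assms(1)
proof (induction q)
  case 0
  show ?case by simp
next
  case (Suc q)
  have "exp (real (Suc q) / real N / 2) \<le> 1 + real (Suc q) / real N"
    using Suc.prems by (intro exp_half_le) auto
  then have e: "real N * exp (real (Suc q) / (2 * real N)) \<le> real (N + Suc q)"
    using assms(2) by (simp add: field_simps)
  have "real N ^ Suc q * exp (real (Suc q * (Suc q + 1)) / (4 * real N))
      = (real N ^ q * exp (real (q * (q + 1)) / (4 * real N))) * (real N * exp (real (Suc q) / (2 * real N)))"
  proof -
    have "real (Suc q * (Suc q + 1)) / (4 * real N)
        = real (q * (q + 1)) / (4 * real N) + real (Suc q) / (2 * real N)"
      using assms(2) by (simp add: field_simps)
    then show ?thesis by (simp add: exp_add mult_ac)
  qed
  also have "\<dots> \<le> (fact q * real ((N + q) choose q)) * real (N + Suc q)"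
    by (rule mult_mono[OF _ e]) (use Suc in auto)
  also have "\<dots> = fact q * real (Suc (N + q) * ((N + q) choose q))"
    by (simp only: of_nat_mult add_Suc_right mult_ac)
  also have "Suc (N + q) * ((N + q) choose q) = Suc q * (Suc (N + q) choose Suc q)"
    by (rule Suc_times_binomial[symmetric])
  also have "fact q * real (Suc q * (Suc (N + q) choose Suc q))
      = fact (Suc q) * real ((N + Suc q) choose Suc q)"
    by (simp only: of_nat_mult fact_Suc add_Suc_right mult_ac)
  finally show ?case .
qed

text \<open>Normalising \<open>gram_poly\<close> to be bounded by 1 on the grid loses
  \<open>sqrt N\<close> through the norm estimate; the growth factor
  \<open>exp (q\<^sup>2 / (4 * N))\<close> beyond the grid has to pay for this and for
  \<open>s\<close>.\<close>

lemma discrete_threshold_poly: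
  fixes s :: real
  assumes "N > 0" "s \<ge> 1" and s: "s * sqrt (real N) \<le> exp ((real q)\<^sup>2 / (4 * real N))"
  shows "\<exists>V :: real poly. degree V \<le> q \<and> (\<forall>j<N. \<bar>poly V (real j)\<bar> \<le> 1) \<and>
           (\<forall>y\<ge>1. poly V (- real y) \<ge> s)"
proof (cases "q \<le> N")
  case True
  define c where "c = fact q / (real N ^ q * sqrt (real N))"
  have c: "c > 0" using assms(1) by (simp add: c_def)
  have "\<bar>poly (smult c (gram_poly N q)) (real j)\<bar> \<le> 1" if "j < N" for j
    using abs_gram_poly_le[OF that, of q] assms(1) c
    by (simp add: abs_mult) (simp add: c_def field_simps)
  moreover have "poly (smult c (gram_poly N q)) (- real y) \<ge> s" if "y \<ge> 1" for y
  proof -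
    have "s * sqrt (real N) \<le> exp (real (q * (q + 1)) / (4 * real N))"
      using s by (rule order_trans) (auto simp: power2_eq_square divide_right_mono)
    then have "real N ^ q * (s * sqrt (real N)) \<le> real N ^ q * exp (real (q * (q + 1)) / (4 * real N))"
      by (intro mult_left_mono) auto
    also have "\<dots> \<le> fact q * real ((N + q) choose q)" by (rule binomial_growth[OF True assms(1)])
    finally have "s \<le> c * real ((N + q) choose q)"
      using assms(1) by (simp add: c_def field_simps)
    also have "\<dots> \<le> c * poly (gram_poly N q) (- real y)"
      using gram_poly_negative_ge[OF that, of N q] c by simp
    finally show ?thesis by simp
  qed
  ultimately show ?thesis using degree_gram_poly[of N q]
    by (intro exI[of _ "smult c (gram_poly N q)"]) (auto intro: order_trans[OF degree_smult_le])
next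
  case False
  \<comment> \<open>In degree \<open>N\<close> the norm is 0, because
    \<open>2 * N choose (2 * N + 1)\<close> is. The polynomial vanishes on the whole grid yet is at
    least 1 at negative integers, so scaling by \<open>s\<close> suffices.\<close>
  have "(\<Sum>x<N. (poly (gram_poly N N) (real x))\<^sup>2) = 0"
    unfolding gram_poly_sum_squares by (simp add: binomial_eq_0)
  then have z: "poly (gram_poly N N) (real j) = 0" if "j < N" for j
    using that by (subst (asm) sum_nonneg_eq_0_iff) auto
  have "poly (smult s (gram_poly N N)) (- real y) \<ge> s" if "y \<ge> 1" for y
  proof -
    have "0 < (N + N) choose N" by (intro zero_less_binomial) auto
    then have "1 \<le> real ((N + N) choose N)" by linarith
    also have "\<dots> \<le> poly (gram_poly N N) (- real y)" by (rule gram_poly_negative_ge[OF that])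
    finally show ?thesis using assms(2) by simp
  qed
  then show ?thesis using z False degree_gram_poly[of N N]
    by (intro exI[of _ "smult s (gram_poly N N)"]) (auto intro: order_trans[OF degree_smult_le])
qed

section \<open>Balancing the degrees\<close>

definition separates :: "nat \<Rightarrow> real \<Rightarrow> real \<Rightarrow> real \<Rightarrow> rpoly pmf \<Rightarrow> bool" where
  "separates n s t \<epsilon> P \<longleftrightarrow>
     (\<forall>x \<in> {1..n} \<rightarrow> {0, 1 :: real}.
        ((\<Sum>i=1..n. x i) \<le> t \<longrightarrow>
           measure_pmf.prob P {p. \<bar>eval_poly p x\<bar> \<le> 1} \<ge> 1 - 1 / s) \<and>
        ((\<Sum>i=1..n. x i) \<in> {t <..< t + \<epsilon> * real n} \<longrightarrow>
           measure_pmf.prob P {p. eval_poly p x > 1} \<ge> 1 - 1 / s) \<and>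
        ((\<Sum>i=1..n. x i) \<ge> t + \<epsilon> * real n \<longrightarrow>
           measure_pmf.prob P {p. eval_poly p x \<ge> s} \<ge> 1 - 1 / s))"

text \<open>As \<open>s\<close> tends to 1, \<open>ln s\<close> tends to 0 and only constants remain
  affordable. A fair coin between \<open>0\<close> and \<open>s\<close> suffices:
  \<open>1 - 1 / s \<le> 1 / 2\<close>, and each requirement accepts one of the two
  constants.\<close>

lemma separates_small:
  assumes s: "1 < s" "s \<le> 2"
  shows "\<exists>P. prob_poly n P \<and> prob_poly_degree_le P 0 \<and> separates n s t \<epsilon> P"
proof -
  define D :: "((nat \<Rightarrow> real) \<Rightarrow> real) pmf"
    where "D = map_pmf (\<lambda>b x. if b then s else 0) (bernoulli_pmf (1 / 2))"
  have "polyfun n 0 f" if "f \<in> set_pmf D" for f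
    using that by (auto simp: D_def intro: polyfun.const)
  from realise_polyfun_pmf[OF this] obtain P where P: "prob_poly n P"
    "\<And>p. p \<in> set_pmf P \<Longrightarrow> total_degree p \<le> 0"
    "\<And>x B. measure_pmf.prob P {p. B (eval_poly p x)} = measure_pmf.prob D {f. B (f x)}" by metis
  have "1 - 1 / s \<le> 1 / 2" using s by (simp add: field_simps)
  moreover have "1 / 2 \<le> measure_pmf.prob P {p. B (eval_poly p x)}" if "B 0 \<or> B s" for B x
  proof -
    from that obtain b where b: "B (if b then s else 0)" by (metis (full_types))
    have "1 / 2 = measure_pmf.prob (bernoulli_pmf (1 / 2)) {b}"
      by (cases b) (simp_all add: measure_pmf_single)
    also have "\<dots> \<le> measure_pmf.prob D {f. B (f x)}"
      unfolding D_def measure_map_pmf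
      by (rule measure_pmf.finite_measure_mono) (use b in auto)
    finally show ?thesis by (simp add: P(3))
  qed
  ultimately have "1 - 1 / s \<le> measure_pmf.prob P {p. B (eval_poly p x)}" if "B 0 \<or> B s" for B x
    using that order_trans by blast
  note prob = this
  have "separates n s t \<epsilon> P"
    unfolding separates_def
  proof (intro ballI conjI impI)
    fix x
    show "1 - 1 / s \<le> measure_pmf.prob P {p. \<bar>eval_poly p x\<bar> \<le> 1}"
      by (rule prob[of "\<lambda>v. \<bar>v\<bar> \<le> 1"]) simp
    show "1 - 1 / s \<le> measure_pmf.prob P {p. eval_poly p x > 1}"
      by (rule prob[of "\<lambda>v. v > 1"]) (simp add: s)
    show "1 - 1 / s \<le> measure_pmf.prob P {p. eval_poly p x \<ge> s}"
      by (rule prob[of "\<lambda>v. v \<ge> s"]) simp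
  qed
  moreover have "prob_poly_degree_le P 0" using P(2) by (auto simp: prob_poly_degree_le_def)
  ultimately show ?thesis using P(1) by blast
qed

text \<open>The summand 2 pays for the factor 3, as \<open>exp 2 \<ge> 3\<close>.\<close>

lemma three_exp_minus_le:
  fixes s :: real
  assumes "s > 0" "ln s + 2 \<le> L"
  shows "3 * exp (- L) \<le> 1 / s"
proof -
  have "exp (- L) \<le> exp (- 2) * exp (- ln s)"
    using assms(2) by (simp flip: exp_add)
  also have "\<dots> = exp (- 2) / s" using assms(1) by (simp add: exp_minus divide_inverse)
  also have "\<dots> \<le> (1 / 3) / s"
    using exp_ge_add_one_self[of "2::real"] assms(1)
    by (intro divide_right_mono) (auto simp: exp_minus field_simps)
  finally show ?thesis by simp
qed

text \<open>A sample of size about \<open>L / \<alpha>\<^sup>2\<close> resolves the window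
  \<open>w = 2 * n * \<alpha>\<close>, and its threshold has degree of order
  \<open>L / \<alpha>\<close>. The gap \<open>\<epsilon> * n\<close> equals
  \<open>w * \<alpha>\<^sup>2 / 2\<close>, so the Chebyshev bound at \<open>u = \<alpha>\<close>
  reaches \<open>exp L / 2\<close> with degree about \<open>L / \<alpha>\<close> as well.\<close>

lemma separates_approx:
  assumes n: "n \<ge> 1" and s: "s \<ge> 2" and \<epsilon>: "0 < \<epsilon>" "\<epsilon> \<le> 1"
  shows "\<exists>P. prob_poly n P \<and> prob_poly_degree_le P (320 * ((1 / \<epsilon>) powr (1 / 3) * ln s)) \<and>
             separates n s t \<epsilon> P"
proof -
  define L where "L = ln s + 2"
  define \<alpha> where "\<alpha> = \<epsilon> powr (1 / 3)"
  define m where "m = nat \<lceil>L / \<alpha>\<^sup>2\<rceil>"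
  define d where "d = nat \<lceil>L / \<alpha>\<rceil>"
  define w where "w = 2 * real n * \<alpha>"
  have "ln s \<ge> ln 2" using s by simp
  then have ln_s: "ln s \<ge> 2 / 3" using ln2_ge_two_thirds by linarith
  \<comment> \<open>From \<open>ln s \<ge> 2 / 3\<close>, the summand 2 is at most
    \<open>3 * ln s\<close>.\<close>
  then have L: "L \<ge> 1" "L \<le> 4 * ln s" by (auto simp: L_def)
  have \<alpha>: "0 < \<alpha>" "\<alpha> \<le> 1" using \<epsilon> by (auto simp: \<alpha>_def intro: powr_le1)
  have cube: "\<alpha> ^ 3 = \<epsilon>"
    using \<epsilon> unfolding \<alpha>_def by (simp add: powr_powr flip: powr_numeral)
  have inv: "(1 / \<epsilon>) powr (1 / 3) = 1 / \<alpha>"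
    using \<epsilon> by (simp add: \<alpha>_def powr_divide)
  have "\<alpha>\<^sup>2 \<le> 1" using \<alpha> by (simp add: power_le_one)
  then have La: "1 \<le> L / \<alpha>\<^sup>2" "1 \<le> L / \<alpha>" using L \<alpha> by (auto simp: field_simps)
  then have m: "L / \<alpha>\<^sup>2 \<le> real m" "real m \<le> 2 * (L / \<alpha>\<^sup>2)"
    and d: "L / \<alpha> \<le> real d" "real d \<le> 2 * (L / \<alpha>)"
    unfolding m_def d_def by linarith+
  have "m \<ge> 1" "d > 0" using La m(1) d(1) by linarith+
  have w: "w > 0" using n \<alpha> by (simp add: w_def)
  from chebyshev_threshold_poly[OF w \<open>d > 0\<close>, of t] obtain V :: "real poly" where V:
    "degree V \<le> d" "\<And>z. t - w \<le> z \<Longrightarrow> z \<le> t \<Longrightarrow> \<bar>poly V z\<bar> \<le> 1"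
    "\<And>z. z > t \<Longrightarrow> poly V z > 1"
    "\<And>u z. 0 \<le> u \<Longrightarrow> u \<le> 1 \<Longrightarrow> t + w * u\<^sup>2 / 2 \<le> z \<Longrightarrow> poly V z \<ge> exp (real d * u) / 2" by blast
  have big: "poly V z \<ge> s" if "z \<ge> t + \<epsilon> * real n" for z
  proof -
    have "w * \<alpha>\<^sup>2 / 2 = \<epsilon> * real n"
      by (simp add: w_def cube[symmetric] power2_eq_square power3_eq_cube)
    with that have "t + w * \<alpha>\<^sup>2 / 2 \<le> z" by simp
    from V(4)[OF _ \<alpha>(2) this] \<alpha> have "exp (real d * \<alpha>) / 2 \<le> poly V z" by simp
    moreover have "exp L \<le> exp (real d * \<alpha>)" using d(1) \<alpha> by (simp add: field_simps)
    moreover have "2 * s \<le> exp L"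
      using exp_ge_add_one_self[of "2::real"] s by (simp add: L_def exp_add mult.commute)
    ultimately show ?thesis by linarith
  qed
  \<comment> \<open>In units of \<open>L / \<alpha>\<close> the degree is at most
    \<open>48 * 3 / 2 + 2 = 74\<close>, and \<open>74 * 4 \<le> 320\<close>.\<close>
  have deg: "48 * sqrt (real m * L) + real (degree V) \<le> 320 * ((1 / \<epsilon>) powr (1 / 3) * ln s)"
  proof -
    have "real m * L \<le> 2 * (L / \<alpha>\<^sup>2) * L" using m(2) L by (intro mult_right_mono) auto
    also have "\<dots> = 2 * (L / \<alpha>)\<^sup>2" by (simp add: power2_eq_square)
    also have "\<dots> \<le> (3 / 2 * (L / \<alpha>))\<^sup>2"
      unfolding power_mult_distrib[of _ "L / \<alpha>"] by (intro mult_right_mono) (simp_all add: power2_eq_square)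
    finally have "sqrt (real m * L) \<le> 3 / 2 * (L / \<alpha>)" using L \<alpha> by (intro real_le_lsqrt) auto
    then have "48 * sqrt (real m * L) + real (degree V) \<le> 74 * (L / \<alpha>)" using d(2) V(1) by linarith
    also have "\<dots> \<le> 74 * (4 * ln s / \<alpha>)" using L \<alpha> by (intro mult_left_mono divide_right_mono) auto
    also have "\<dots> \<le> 320 * ((1 / \<epsilon>) powr (1 / 3) * ln s)"
      using ln_s \<alpha> by (simp add: inv field_simps)
    finally show ?thesis .
  qed
  have "2 * L * (real n)\<^sup>2 \<le> real m * w\<^sup>2"
  proof -
    have "L \<le> real m * \<alpha>\<^sup>2" using m(1) \<alpha> by (simp add: field_simps)
    then have "L * (4 * (real n)\<^sup>2) \<le> real m * \<alpha>\<^sup>2 * (4 * (real n)\<^sup>2)" by (intro mult_right_mono) auto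
    moreover have "0 \<le> L * (real n)\<^sup>2" using L by simp
    ultimately show ?thesis by (simp add: w_def power_mult_distrib mult_ac)
  qed
  from sampled_threshold_product[OF n \<open>m \<ge> 1\<close> L(1) w this deg, of t] obtain P where
    P: "prob_poly n P" "prob_poly_degree_le P (320 * ((1 / \<epsilon>) powr (1 / 3) * ln s))"
    "\<forall>x \<in> {1..n} \<rightarrow> {0, 1 :: real}. \<forall>B.
       ((\<Sum>i=1..n. x i) \<le> t - w \<longrightarrow> B 0) \<and>
       (t - w < (\<Sum>i=1..n. x i) \<and> (\<Sum>i=1..n. x i) \<le> t \<longrightarrow> B 0 \<and> B (poly V (\<Sum>i=1..n. x i))) \<and>
       (t < (\<Sum>i=1..n. x i) \<longrightarrow> B (poly V (\<Sum>i=1..n. x i))) \<longrightarrow>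
         1 - 3 * exp (- L) \<le> measure_pmf.prob P {p. B (eval_poly p x)}"
    by (elim exE conjE)
  have err: "1 - 1 / s \<le> 1 - 3 * exp (- L)" using three_exp_minus_le[of s L] s by (simp add: L_def)
  have "separates n s t \<epsilon> P"
    unfolding separates_def
  proof (intro ballI conjI impI order_trans[OF err])
    fix x assume x: "x \<in> {1..n} \<rightarrow> {0, 1 :: real}"
    let ?z = "\<Sum>i=1..n. x i"
    have \<epsilon>n: "0 < \<epsilon> * real n" using \<epsilon> n by simp
    show "1 - 3 * exp (- L) \<le> measure_pmf.prob P {p. \<bar>eval_poly p x\<bar> \<le> 1}" if "?z \<le> t"
      by (rule P(3)[rule_format, OF x, of "\<lambda>v. \<bar>v\<bar> \<le> 1"]) (use that V(2) in auto)
    show "1 - 3 * exp (- L) \<le> measure_pmf.prob P {p. eval_poly p x > 1}"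
      if "?z \<in> {t <..< t + \<epsilon> * real n}"
      by (rule P(3)[rule_format, OF x, of "\<lambda>v. v > 1"]) (use that V(3) w in auto)
    show "1 - 3 * exp (- L) \<le> measure_pmf.prob P {p. eval_poly p x \<ge> s}" if "?z \<ge> t + \<epsilon> * real n"
      by (rule P(3)[rule_format, OF x, of "\<lambda>v. v \<ge> s"]) (use that big \<epsilon>n w in auto)
  qed
  with P(1,2) show ?thesis by blast
qed

text \<open>With \<open>a\<close> and \<open>k\<close> the cube roots of \<open>n\<close> and
  \<open>K\<close>, a sample of about \<open>a\<^sup>2 * k\<close> bits gives both factors degree of
  order \<open>a * k\<^sup>2\<close>. Sums are integers, so the univariate factor need only be
  bounded at the \<open>N\<close> integers of the window. The \<open>ln n\<close> inside
  \<open>K\<close> absorbs the loss of \<open>sqrt N\<close>.\<close>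

lemma separates_exact:
  assumes n: "n \<ge> 1" and s: "s \<ge> 2"
  shows "\<exists>P. prob_poly n P \<and>
             prob_poly_degree_le P (320 * (real n powr (1 / 3) * ln (real n * s) powr (2 / 3))) \<and>
             separates n s t (1 / real n) P"
proof -
  define K where "K = ln (real n * s) + 2"
  define a where "a = real n powr (1 / 3)"
  define k where "k = K powr (1 / 3)"
  define m where "m = nat \<lceil>a\<^sup>2 * k\<rceil>"
  define N where "N = 2 * m"
  \<comment> \<open>Makes the growth exponent \<open>q\<^sup>2 / (4 * N)\<close> at least
    \<open>2 * K\<close>: one \<open>exp K\<close> covers \<open>n * s\<close>, the other covers
    \<open>2 * K\<close>.\<close>
  define q where "q = nat \<lceil>sqrt (8 * real N * K)\<rceil>"
  define l where "l = \<lfloor>t\<rfloor>"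
  have ns: "real n * s \<ge> 2" using n s mult_mono[of 1 "real n" 2 s] by simp
  then have "ln (real n * s) \<ge> ln 2" by simp
  then have ln_ns: "ln (real n * s) \<ge> 2 / 3" using ln2_ge_two_thirds by linarith
  then have K: "K \<ge> 1" "K \<le> 4 * ln (real n * s)" by (auto simp: K_def)
  have a: "a \<ge> 1" "a ^ 3 = real n"
    using n unfolding a_def by (auto simp: powr_powr ge_one_powr_ge_zero simp flip: powr_numeral)
  have k: "k \<ge> 1" "k ^ 3 = K"
    using K unfolding k_def by (auto simp: powr_powr ge_one_powr_ge_zero simp flip: powr_numeral)
  have ak: "1 \<le> a\<^sup>2 * k" using a k mult_mono[of 1 "a\<^sup>2" 1 k] by simp
  then have m: "a\<^sup>2 * k \<le> real m" "real m \<le> 2 * (a\<^sup>2 * k)"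
    unfolding m_def by linarith+
  then have "m \<ge> 1" using ak by linarith
  then have N: "N > 0" "real N = 2 * real m" by (simp_all add: N_def)
  have ak2: "1 \<le> a * k\<^sup>2" using a k mult_mono[of 1 a 1 "k\<^sup>2"] by simp
  have mK: "real m * K \<le> 2 * (a * k\<^sup>2)\<^sup>2"
  proof -
    have "real m * K \<le> 2 * (a\<^sup>2 * k) * K" using m(2) K by (intro mult_right_mono) auto
    also have "\<dots> = 2 * (a * k\<^sup>2)\<^sup>2"
      unfolding k(2)[symmetric] by (simp add: power2_eq_square power3_eq_cube)
    finally show ?thesis .
  qed
  have q: "sqrt (8 * real N * K) \<le> real q" "real q \<le> sqrt (8 * real N * K) + 1"
    unfolding q_def using K by (auto intro: real_nat_ceiling_ge) 
  have growth: "s * sqrt (real N) \<le> exp ((real q)\<^sup>2 / (4 * real N))"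
  proof -
    have "real N \<le> 4 * (a\<^sup>2 * k)" using N(2) m(2) by linarith
    also have "\<dots> \<le> 4 * ((real n)\<^sup>2 * K\<^sup>2)"
    proof (intro mult_left_mono mult_mono power_mono)
      show "a \<le> real n" using a power_increasing[of 1 3 a] by simp
      have "k \<le> K" using k power_increasing[of 1 3 k] by simp
      also have "K \<le> K\<^sup>2" using K by (simp add: power2_eq_square)
      finally show "k \<le> K\<^sup>2" .
    qed (use a k in auto)
    also have "\<dots> = (2 * real n * K)\<^sup>2" by (simp add: power_mult_distrib)
    finally have "sqrt (real N) \<le> 2 * real n * K" using K by (intro real_le_lsqrt) auto
    then have "s * sqrt (real N) \<le> s * (2 * real n * K)" using s by (intro mult_left_mono) auto
    also have "\<dots> = (real n * s) * (2 * K)" by simp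
    also have "\<dots> \<le> exp K * exp K"
    proof (intro mult_mono)
      have "real n * s = exp (ln (real n * s))" using ns by simp
      also have "\<dots> \<le> exp K" by (simp add: K_def)
      finally show "real n * s \<le> exp K" .
      have "0 \<le> (1 - K / 2)\<^sup>2" by simp
      then have "2 * K \<le> (1 + K / 2)\<^sup>2" by (simp add: power2_eq_square algebra_simps)
      also have "\<dots> \<le> (exp (K / 2))\<^sup>2" using K by (intro power_mono exp_ge_add_one_self) auto
      also have "\<dots> = exp K" by (simp add: power2_eq_square flip: exp_add)
      finally show "2 * K \<le> exp K" .
    qed (use K in auto)
    also have "\<dots> = exp (2 * K)" by (simp flip: exp_add)
    also have "\<dots> \<le> exp ((real q)\<^sup>2 / (4 * real N))"
    proof -
      have "8 * real N * K = (sqrt (8 * real N * K))\<^sup>2" using K by simp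
      also have "\<dots> \<le> (real q)\<^sup>2" using q(1) K by (intro power_mono) auto
      finally show ?thesis using N by (simp add: field_simps)
    qed
    finally show ?thesis .
  qed
  from discrete_threshold_poly[OF N(1) _ growth] s obtain V :: "real poly" where V:
    "degree V \<le> q" "\<And>j. j < N \<Longrightarrow> \<bar>poly V (real j)\<bar> \<le> 1" "\<And>y. y \<ge> 1 \<Longrightarrow> poly V (- real y) \<ge> s" by auto
  \<comment> \<open>Reflection at \<open>l\<close>: the integers \<open>z\<close> with
    \<open>l - N < z \<le> l\<close> become the grid \<open>0, ..., N - 1\<close>, and those above
    \<open>l\<close> become negative.\<close>
  define W where "W = pcompose V [:real_of_int l, -1:]"
  have W: "poly W z = poly V (real_of_int l - z)" for z by (simp add: W_def poly_pcompose)
  have "degree W \<le> q" using V(1) by (simp add: W_def degree_pcompose)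
  \<comment> \<open>In units of \<open>a * k\<^sup>2\<close> the threshold costs
    \<open>48 * 3 / 2 = 72\<close>, the univariate factor 6, and rounding up \<open>q\<close> one
    more; \<open>79 * 4 \<le> 320\<close>.\<close>
  have deg: "48 * sqrt (real m * K) + real (degree W)
      \<le> 320 * (real n powr (1 / 3) * ln (real n * s) powr (2 / 3))"
  proof -
    have "2 * (a * k\<^sup>2)\<^sup>2 \<le> (3 / 2 * (a * k\<^sup>2))\<^sup>2"
      unfolding power_mult_distrib[of _ "a * k\<^sup>2"] by (intro mult_right_mono) (simp_all add: power2_eq_square)
    with mK have "sqrt (real m * K) \<le> 3 / 2 * (a * k\<^sup>2)"
      using ak2 by (intro real_le_lsqrt) auto
    moreover have "sqrt (8 * real N * K) \<le> 6 * (a * k\<^sup>2)"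
    proof (intro real_le_lsqrt)
      have "8 * real N * K = 16 * (real m * K)" by (simp add: N)
      also have "\<dots> \<le> 36 * (a * k\<^sup>2)\<^sup>2" using mK zero_le_power2[of "a * k\<^sup>2"] by linarith
      also have "\<dots> = (6 * (a * k\<^sup>2))\<^sup>2" by (simp add: power_mult_distrib)
      finally show "8 * real N * K \<le> (6 * (a * k\<^sup>2))\<^sup>2" .
    qed (use ak2 in auto)
    ultimately have "48 * sqrt (real m * K) + real (degree W) \<le> 79 * (a * k\<^sup>2)"
      using q(2) \<open>degree W \<le> q\<close> ak2 by linarith
    also have "\<dots> \<le> 79 * (a * (4 * ln (real n * s) powr (2 / 3)))"
    proof (intro mult_left_mono)
      have "k\<^sup>2 = K powr (2 / 3)"
        using K unfolding k_def by (simp add: powr_powr flip: powr_numeral)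
      also have "\<dots> \<le> (4 * ln (real n * s)) powr (2 / 3)" using K by (intro powr_mono2) auto
      also have "\<dots> = 4 powr (2 / 3) * ln (real n * s) powr (2 / 3)"
        by (rule powr_mult)
      also have "\<dots> \<le> 4 powr 1 * ln (real n * s) powr (2 / 3)"
        by (intro mult_right_mono powr_mono) auto
      finally show "k\<^sup>2 \<le> 4 * ln (real n * s) powr (2 / 3)" by simp
    qed (use a in auto)
    also have "\<dots> \<le> 320 * (real n powr (1 / 3) * ln (real n * s) powr (2 / 3))"
      by (simp add: a_def)
    finally show ?thesis .
  qed
  have w: "real N > 0" using N by simp
  have "2 * K * (real n)\<^sup>2 \<le> real m * (real N)\<^sup>2"
  proof -
    have "K * (real n)\<^sup>2 = (a\<^sup>2 * k) ^ 3"
      unfolding k(2)[symmetric] a(2)[symmetric] by (simp add: power_mult_distrib mult.commute flip: power_mult)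
    also have "\<dots> \<le> real m ^ 3" using m ak by (intro power_mono) auto
    finally have "2 * (K * (real n)\<^sup>2) \<le> 4 * real m ^ 3" using zero_le_power[of "real m" 3] by linarith
    then show ?thesis
      by (simp add: N power_mult_distrib power3_eq_cube power2_eq_square mult_ac)
  qed
  from sampled_threshold_product[OF n \<open>m \<ge> 1\<close> K(1) w this deg, of l] obtain P where
    P: "prob_poly n P" "prob_poly_degree_le P (320 * (real n powr (1 / 3) * ln (real n * s) powr (2 / 3)))"
    "\<forall>x \<in> {1..n} \<rightarrow> {0, 1 :: real}. \<forall>B.
       ((\<Sum>i=1..n. x i) \<le> l - real N \<longrightarrow> B 0) \<and>
       (l - real N < (\<Sum>i=1..n. x i) \<and> (\<Sum>i=1..n. x i) \<le> l \<longrightarrow> B 0 \<and> B (poly W (\<Sum>i=1..n. x i))) \<and>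
       (l < (\<Sum>i=1..n. x i) \<longrightarrow> B (poly W (\<Sum>i=1..n. x i))) \<longrightarrow>
         1 - 3 * exp (- K) \<le> measure_pmf.prob P {p. B (eval_poly p x)}"
    by (elim exE conjE)
  have err: "1 - 1 / s \<le> 1 - 3 * exp (- K)"
    using three_exp_minus_le[of s K] s n by (simp add: K_def ln_mult)
  have "separates n s t (1 / real n) P"
    unfolding separates_def
  proof (intro ballI conjI impI order_trans[OF err])
    fix x assume x: "x \<in> {1..n} \<rightarrow> {0, 1 :: real}"
    let ?z = "\<Sum>i=1..n. x i"
    obtain c where c: "?z = real c" using sum_01_is_nat[OF x] by blast
    have le: "?z \<le> t \<longleftrightarrow> ?z \<le> l"
      unfolding c l_def by (metis le_floor_iff of_int_le_iff of_int_of_nat_eq)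
    have below: "\<bar>poly W ?z\<bar> \<le> 1" if "l - real N < ?z" "?z \<le> l"
    proof -
      have "real_of_int l - ?z = real (nat (l - int c))" "nat (l - int c) < N"
        using that unfolding c by linarith+
      then show ?thesis using V(2) by (simp add: W)
    qed
    \<comment> \<open>The value is already at least \<open>s\<close> at the first integer above
      \<open>l\<close>, so the last two requirements are met together, using
      \<open>s > 1\<close>.\<close>
    have above: "poly W ?z \<ge> s" if "?z > l"
    proof -
      have "real_of_int l - ?z = - real (nat (int c - l))" "nat (int c - l) \<ge> 1"
        using that unfolding c by linarith+
      then show ?thesis using V(3)[of "nat (int c - l)"] by (simp only: W)
    qed
    have s1: "s > 1" using s by simp
    have n0: "1 / real n * real n = 1" using n by simp
    show "1 - 3 * exp (- K) \<le> measure_pmf.prob P {p. \<bar>eval_poly p x\<bar> \<le> 1}" if "?z \<le> t"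
      by (rule P(3)[rule_format, OF x, of "\<lambda>v. \<bar>v\<bar> \<le> 1"]) (use that le below in auto)
    show "1 - 3 * exp (- K) \<le> measure_pmf.prob P {p. eval_poly p x > 1}"
      if "?z \<in> {t <..< t + 1 / real n * real n}"
      by (rule P(3)[rule_format, OF x, of "\<lambda>v. v > 1"]) (use that le above s1 in force)+
    show "1 - 3 * exp (- K) \<le> measure_pmf.prob P {p. eval_poly p x \<ge> s}"
      if "?z \<ge> t + 1 / real n * real n"
    proof -
      have "\<not> ?z \<le> l" using that le unfolding n0 by linarith
      then show ?thesis by (intro P(3)[rule_format, OF x, of "\<lambda>v. v \<ge> s"]) (use above N in auto)
    qed
  qed
  with P(1,2) show ?thesis by blast
qed

theorem theorem1p3:
  shows "\<exists>(P :: nat \<Rightarrow> real \<Rightarrow> real \<Rightarrow> real \<Rightarrow> rpoly pmf) (C :: real).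
    \<forall>(n::nat) (s::real) (t::real) (\<epsilon>::real). n \<ge> 1 \<and> s > 1 \<and> 0 < \<epsilon> \<and> \<epsilon> \<le> 1 \<longrightarrow>
      prob_poly n (P n s t \<epsilon>) \<and>
      prob_poly_degree_le (P n s t \<epsilon>) (C * ((1 / \<epsilon>) powr (1 / 3) * ln s)) \<and>
      (\<forall>x \<in> {1..n} \<rightarrow> {0, 1 :: real}.
        ((\<Sum>i=1..n. x i) \<le> t \<longrightarrow>
           measure_pmf.prob (P n s t \<epsilon>) {p. \<bar>eval_poly p x\<bar> \<le> 1} \<ge> 1 - 1 / s) \<and>
        ((\<Sum>i=1..n. x i) \<in> {t <..< t + \<epsilon> * real n} \<longrightarrow>
           measure_pmf.prob (P n s t \<epsilon>) {p. eval_poly p x > 1} \<ge> 1 - 1 / s) \<and>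
        ((\<Sum>i=1..n. x i) \<ge> t + \<epsilon> * real n \<longrightarrow>
           measure_pmf.prob (P n s t \<epsilon>) {p. eval_poly p x \<ge> s} \<ge> 1 - 1 / s)) \<and>
      (\<epsilon> = 1 / real n \<longrightarrow>
        prob_poly_degree_le (P n s t \<epsilon>)
          (C * (real n powr (1 / 3) * ln (real n * s) powr (2 / 3))))"
proof -
  define d1 d2 where "d1 \<epsilon> s = 320 * ((1 / \<epsilon>) powr (1 / 3) * ln s)"
    and "d2 n s = 320 * (real n powr (1 / 3) * ln (real n * s) powr (2 / 3))"
    for \<epsilon> s :: real and n :: nat
  have mono: "prob_poly_degree_le P d \<Longrightarrow> d \<le> e \<Longrightarrow> prob_poly_degree_le P e" for P d e
    unfolding prob_poly_degree_le_def using order_trans by blast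
  define good where "good n s t \<epsilon> P \<longleftrightarrow>
      prob_poly n P \<and> prob_poly_degree_le P (d1 \<epsilon> s) \<and> separates n s t \<epsilon> P \<and>
      (\<epsilon> = 1 / real n \<longrightarrow> prob_poly_degree_le P (d2 n s))" for n s t \<epsilon> P
  have "\<exists>P. good n s t \<epsilon> P" if "n \<ge> 1 \<and> s > 1 \<and> 0 < \<epsilon> \<and> \<epsilon> \<le> 1" for n s t \<epsilon>
  proof -
    \<comment> \<open>For \<open>\<epsilon> = 1 / n\<close> a single distribution must meet both
      degree bounds, so the construction with the smaller bound is taken.\<close>
    consider "s \<le> 2" | "s \<ge> 2" "\<epsilon> = 1 / real n" "d2 n s \<le> d1 \<epsilon> s"
      | "s \<ge> 2" "\<epsilon> \<noteq> 1 / real n \<or> d1 \<epsilon> s \<le> d2 n s" by linarith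
    then show ?thesis
    proof cases
      case 1
      have "0 \<le> d1 \<epsilon> s" "0 \<le> d2 n s" using that by (simp_all add: d1_def d2_def)
      with separates_small[of s n t \<epsilon>] 1 that mono show ?thesis unfolding good_def by blast
    next
      case 2
      with separates_exact[of n s t] that mono show ?thesis unfolding good_def d2_def by blast
    next
      case 3
      with separates_approx[of n s \<epsilon> t] that mono show ?thesis unfolding good_def d1_def by blast
    qed
  qed
  then have "good n s t \<epsilon> (SOME P. good n s t \<epsilon> P)"
    if "n \<ge> 1 \<and> s > 1 \<and> 0 < \<epsilon> \<and> \<epsilon> \<le> 1" for n s t \<epsilon>
    using that by (intro someI_ex[of "good n s t \<epsilon>"]) blast
  then show ?thesis
    by (intro exI[of _ "\<lambda>n s t \<epsilon>. SOME P. good n s t \<epsilon> P"] exI[of _ 320] allI impI)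
       (unfold good_def d1_def d2_def separates_def, blast)
qed

end
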